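(* Let $N\cong\mathbb{Z}^n$ and let $P\subset N_{\mathbb{R}}$ be an $n$-dimensional Fano simplex with distinguished solution $\mathbf{a}_P=(a_0,\dots,a_n)$ of its weighted Markov-type equation $\mathrm{DE}_P$, written in the form $$c_0x_0^2+\cdots+c_nx_n^2=m\,x_0\cdots x_n .$$ Then $$\mathrm{Vol}(P^\vee)=\frac{m^n}{n!\,\prod_{i=0}^n c_i}\cdot\frac{\left(\prod_{i=0}^n a_i\right)^{n-2}}{\mathrm{mult}(P)} .$$ In particular, if $P$ and $Q$ are related by a mutation over an admissible facet and $\mathbf{a}_Q=(a_0',\dots,a_n')$, then $$\frac{\left(\prod_{i=0}^n a_i\right)^{n-2}}{\mathrm{mult}(P)}=\frac{\left(\prod_{i=0}^n a_i'\right)^{n-2}}{\mathrm{mult}(Q)} .$$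
   Context: Let $M=\mathrm{Hom}(N,\mathbb{Z})$, $N_{\mathbb{R}}=N\otimes\mathbb{R}$, $M_{\mathbb{R}}=M\otimes\mathbb{R}$. A Fano simplex is an $n$-dimensional lattice simplex $P\subset N_{\mathbb{R}}$ with the origin in its interior and all vertices primitive in $N$. Its polar dual is $P^\vee=\{u\in M_{\mathbb{R}}:\langle u,v\rangle\ge-1\ \text{for all } v\in P\}$, and $\mathrm{Vol}$ is Lebesgue measure on $M_{\mathbb{R}}$ normalized so that a fundamental parallelepiped of $M$ has volume $1$. Let $v_0,\dots,v_n$ be the vertices of $P$ and $F_i$ the facet opposite $v_i$. Let $\widetilde\lambda_i$ be the index in $N$ of the sublattice spanned by the vertices of $F_i$; the multiplicity is $\mathrm{mult}(P)=\gcd(\widetilde\lambda_0,\dots,\widetilde\lambda_n)$, which equals the index in $N$ of the sublattice generated by all vertices of $P$. Put $\lambda_i=\widetilde\lambda_i/\mathrm{mult}(P)$ and write $\lambda_i=c_ia_i^2$ with $c_i,a_i\in\mathbb{Z}_{>0}$, $c_i$ square-free; then $\mathbf{a}_P=(a_0,\dots,a_n)$. The equation $\mathrm{DE}_P$ is $c_0x_0^2+\cdots+c_nx_n^2=m\,x_0\cdots x_n$, where $m=\frac{c_0a_0^2+\cdots+c_na_n^2}{a_0\cdots a_n}$ is a positive rational number. For a facet $F$ of $P$ let $n_F\in M$ be the primitive outward normal and $d_F\in\mathbb{Z}_{>0}$ with $F\subset\{u:\langle n_F,u\rangle=d_F\}$. $F$ is admissible if for a (equivalently, any) vertex $v$ of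 $F$, $G=\frac1{d_F}(F-v)$ is a lattice polytope. In that case, with $\mathbf{w}_F=-n_F$, $h_{\max}=\max_{x\in P}\langle\mathbf{w}_F,x\rangle$ and $S_h=\mathrm{conv}(\{x\in P\cap N:\langle\mathbf{w}_F,x\rangle=h\})$, the mutation of $P$ over $F$ is $$\mu_F(P)=\mathrm{conv}\Big(\{v\}\cup\bigcup_{h=0}^{h_{\max}}(S_h+hG)\Big),$$ which is again a Fano simplex, independent of the choice of $v$ up to unimodular equivalence. If $F=F_i$ and the chosen vertex is $v=v_r$ ($r\neq i$), its vertices are labelled $v_i'=v_r$, $v_r'=v_i$, $v_j'=v_i+\frac{h_{\max}}{d_{F}}(v_j-v_r)$ for $j\neq i,r$. *)

theory Defs
  imports
    "HOL-Analysis.Analysis"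
    "HOL-Algebra.Coset"
    "HOL-Algebra.Generated_Groups"
    "HOL-Computational_Algebra.Squarefree"
begin

text \<open>
  A basis of \<open>N\<close> is fixed, so that \<open>N\<close> is the integer lattice in \<open>real ^ 'n\<close>, where \<open>n = CARD('n)\<close>.
  The dual basis identifies \<open>M\<close> with the same lattice, the pairing with the inner product, and
  \<open>Vol\<close> with Lebesgue measure.
\<close>

definition int_lattice :: "(real ^ 'n) set" where
  "int_lattice = {x. \<forall>i. x $ i \<in> \<int>}"

definition int_lattice_group :: "(real ^ 'n) monoid" where
  "int_lattice_group = \<lparr>carrier = int_lattice, monoid.mult = (+), one = 0\<rparr>"

text \<open>As usual with \<^const>\<open>card\<close>, an infinite index is \<open>0\<close>.\<close>

definition sublattice_index :: "(real ^ 'n) set \<Rightarrow> nat" where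
  "sublattice_index S = card (rcosets\<^bsub>int_lattice_group\<^esub> (generate int_lattice_group S))"

definition primitive :: "real ^ 'n \<Rightarrow> bool" where
  "primitive u \<longleftrightarrow> u \<in> int_lattice \<and> (\<forall>k::nat. \<forall>y\<in>int_lattice. u = real k *\<^sub>R y \<longrightarrow> k = 1)"

definition lattice_polytope :: "(real ^ 'n) set \<Rightarrow> bool" where
  "lattice_polytope P \<longleftrightarrow> (\<exists>S. finite S \<and> S \<subseteq> int_lattice \<and> P = convex hull S)"

definition fano_simplex :: "(real ^ 'n) set \<Rightarrow> bool" where
  "fano_simplex P \<longleftrightarrow>
     int CARD('n) simplex P \<and> lattice_polytope P \<and> 0 \<in> interior P \<and>
     (\<forall>u. u extreme_point_of P \<longrightarrow> primitive u)"

definition polar_dual :: "(real ^ 'n) set \<Rightarrow> (real ^ 'n) set" where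
  "polar_dual P = {u. \<forall>x\<in>P. u \<bullet> x \<ge> - 1}"

text \<open>
  A labelling \<open>v 0, \<dots>, v n\<close> of the vertices; the values of \<open>v\<close> beyond \<open>n\<close> are irrelevant.
  The facet opposite \<open>v i\<close> has the vertices \<open>v j\<close> with \<open>j \<noteq> i\<close>.
\<close>

definition vertex_labelling :: "(real ^ 'n) set \<Rightarrow> (nat \<Rightarrow> real ^ 'n) \<Rightarrow> bool" where
  "vertex_labelling P v \<longleftrightarrow> bij_betw v {..CARD('n)} {x. x extreme_point_of P}"

definition facet_index :: "(nat \<Rightarrow> real ^ 'n) \<Rightarrow> nat \<Rightarrow> nat" where
  "facet_index v i = sublattice_index (v ` ({..CARD('n)} - {i}))"

definition simplex_mult :: "(nat \<Rightarrow> real ^ 'n) \<Rightarrow> nat" where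
  "simplex_mult v = Gcd (facet_index v ` {..CARD('n)})"

definition weight :: "(nat \<Rightarrow> real ^ 'n) \<Rightarrow> nat \<Rightarrow> nat" where
  "weight v i = facet_index v i div simplex_mult v"

definition markov_c :: "(nat \<Rightarrow> real ^ 'n) \<Rightarrow> nat \<Rightarrow> nat" where
  "markov_c v i = squarefree_part (weight v i)"

definition markov_a :: "(nat \<Rightarrow> real ^ 'n) \<Rightarrow> nat \<Rightarrow> nat" where
  "markov_a v i = square_part (weight v i)"

definition markov_m :: "(nat \<Rightarrow> real ^ 'n) \<Rightarrow> real" where
  "markov_m v =
     (\<Sum>i\<le>CARD('n). real (markov_c v i) * (real (markov_a v i))\<^sup>2) / (\<Prod>i\<le>CARD('n). real (markov_a v i))"

definition markov_equation :: "(nat \<Rightarrow> real ^ 'n) \<Rightarrow> (nat \<Rightarrow> real) \<Rightarrow> bool" where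
  "markov_equation v x \<longleftrightarrow>
     (\<Sum>i\<le>CARD('n). real (markov_c v i) * (x i)\<^sup>2) = markov_m v * (\<Prod>i\<le>CARD('n). x i)"

lemma weight_decomposition: "weight v i = markov_c v i * (markov_a v i)\<^sup>2"
  unfolding markov_c_def markov_a_def by (rule squarefree_decompose)

lemma squarefree_markov_c: "squarefree (markov_c v i)"
  unfolding markov_c_def by (rule squarefree_squarefree_part)

lemma markov_equation_markov_a:
  fixes v :: "nat \<Rightarrow> real ^ 'n"
  assumes "\<And>i. i \<le> CARD('n) \<Longrightarrow> weight v i \<noteq> 0"
  shows "markov_equation v (\<lambda>i. real (markov_a v i))"
  using assms by (simp add: markov_equation_def markov_m_def markov_a_def)

definition facet_normal :: "(real ^ 'n) set \<Rightarrow> (real ^ 'n) set \<Rightarrow> real ^ 'n \<Rightarrow> nat \<Rightarrow> bool" where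
  "facet_normal P F nF dF \<longleftrightarrow>
     primitive nF \<and> dF > 0 \<and> F \<subseteq> {u. nF \<bullet> u = real dF} \<and> P \<subseteq> {u. nF \<bullet> u \<le> real dF}"

definition mutation_factor :: "(real ^ 'n) set \<Rightarrow> nat \<Rightarrow> real ^ 'n \<Rightarrow> (real ^ 'n) set" where
  "mutation_factor F dF u = (\<lambda>x. (1 / real dF) *\<^sub>R (x - u)) ` F"

definition admissible :: "(real ^ 'n) set \<Rightarrow> nat \<Rightarrow> bool" where
  "admissible F dF \<longleftrightarrow> (\<exists>u. u extreme_point_of F \<and> lattice_polytope (mutation_factor F dF u))"

definition max_height :: "(real ^ 'n) set \<Rightarrow> real ^ 'n \<Rightarrow> real" where
  "max_height P w = (SUP x\<in>P. w \<bullet> x)"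

definition lattice_slice :: "(real ^ 'n) set \<Rightarrow> real ^ 'n \<Rightarrow> nat \<Rightarrow> (real ^ 'n) set" where
  "lattice_slice P w h = convex hull {x \<in> P \<inter> int_lattice. w \<bullet> x = real h}"

text \<open>
  Minkowski sums are written out; the summand at height \<open>h\<close> is empty if \<open>P\<close> has no lattice point there.
\<close>

definition mutation ::
  "(real ^ 'n) set \<Rightarrow> (real ^ 'n) set \<Rightarrow> real ^ 'n \<Rightarrow> nat \<Rightarrow> real ^ 'n \<Rightarrow> (real ^ 'n) set" where
  "mutation P F nF dF u =
     convex hull ({u} \<union> (\<Union>h\<in>{h. real h \<le> max_height P (- nF)}.
       {x + real h *\<^sub>R g |x g. x \<in> lattice_slice P (- nF) h \<and> g \<in> mutation_factor F dF u}))"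

definition unimodular_equivalent :: "(real ^ 'n) set \<Rightarrow> (real ^ 'n) set \<Rightarrow> bool" where
  "unimodular_equivalent P Q \<longleftrightarrow> (\<exists>f. linear f \<and> f ` int_lattice = int_lattice \<and> f ` P = Q)"

text \<open>
  The mutation over a facet is determined only up to unimodular equivalence, because of the choice
  of the vertex \<open>u\<close>; all choices, and all representatives of the class, are allowed for \<open>Q\<close>.
\<close>

definition related_by_mutation :: "(real ^ 'n) set \<Rightarrow> (real ^ 'n) set \<Rightarrow> bool" where
  "related_by_mutation P Q \<longleftrightarrow>
     (\<exists>F nF dF u. F facet_of P \<and> facet_normal P F nF dF \<and> admissible F dF \<and>
        u extreme_point_of F \<and> unimodular_equivalent (mutation P F nF dF u) Q)"

end

theory Submission
  imports Defs
begin

text \<open>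
  Write \<open>\<Lambda> l\<close> for the index of the sublattice spanned by the vertices of the facet opposite \<open>v l\<close>.
  Two facts about these numbers carry everything.

  \<^item> \<open>\<Lambda> l\<close> is the absolute value of the determinant of the vertices \<open>v j\<close> with \<open>j \<noteq> l\<close>
    (\<open>sublattice_index_eq_det\<close>, \<open>facet_index_eq_det\<close>). Indeed, for a full sublattice \<open>L\<close>
    of the integer lattice, both its half-open parallelepiped and a union of unit cubes, one for each
    coset of \<open>L\<close>, tile space under \<open>L\<close>, and two such tiles have the same measure.
  \<^item> \<open>\<Sum>l. \<Lambda> l *\<^sub>R v l = 0\<close> (\<open>facet_index_relation\<close>): this is Cramer's rule, the signs being
    right because the origin is interior.

  For the volume, an affine map takes the polar dual to the standard simplex: by the relation, the
  inequalities \<open>u \<bullet> v l \<ge> -1\<close> say that the numbers \<open>\<Lambda> l * (u \<bullet> v l + 1) / (\<Sum>j. \<Lambda> j)\<close>,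
  which add up to \<open>1\<close>, are nonnegative. Hence the volume is
  \<open>(\<Sum>l. \<Lambda> l) ^ n / (fact n * (\<Prod>l. \<Lambda> l))\<close>, and substituting \<open>\<Lambda> l = mult * c l * (a l)\<^sup>2\<close> gives
  the formula.

  For a mutation over the facet opposite \<open>v i\<close>, with the vertex \<open>u\<close> of that facet as origin of the
  factor, let \<open>h\<close> be the height of \<open>v i\<close>, \<open>d\<close> that of the facet and \<open>k = h / d\<close>. There is a linear
  map \<open>T\<close>, a reflection scaled by \<open>k\<close>, such that the vertices of the mutation are \<open>T (v j)\<close> for
  \<open>j \<noteq> i\<close> together with \<open>u = T (v i) / k\<^sup>2\<close> (\<open>mutation_eq_hull\<close>, \<open>mutation_map_apex\<close>).
  As \<open>\<bar>det T\<bar> = k ^ n\<close>, the facet indices of the mutation are \<open>k ^ n * \<Lambda> i\<close> and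
  \<open>k powi (n - 2) * \<Lambda> j\<close> (\<open>mutation_facet_indices\<close>).

  It remains to see how these numbers split into multiplicity and weights. As \<open>v i\<close> is primitive,
  the weights with index \<open>j \<noteq> i\<close> have no common divisor (\<open>Gcd_omit_primitive\<close>), and the same holds
  after the mutation, where \<open>u\<close> has taken the place of \<open>v i\<close>. So these weights, being proportional
  to the old ones, are equal to them; the multiplicity is multiplied by \<open>k powi (n - 2)\<close> and the
  weight with index \<open>i\<close> by \<open>k\<^sup>2\<close>, that is, \<open>a i\<close> by \<open>k\<close>. So the numerator and the denominator of the
  invariant are both multiplied by \<open>k powi (n - 2)\<close>.
\<close>

section \<open>Linear images and Lebesgue measure\<close>

text \<open>
  A shear is a row operation on the identity matrix. This gives its determinant for every finite index
  type, ordered or not, whereas triangularity makes sense only for an ordered one.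
\<close>
lemma det_matrix_shear:
  fixes m n :: "'n::finite"
  assumes "m \<noteq> n"
  shows "det (matrix (\<lambda>x::real^'n. \<chi> i. if i = m then x $ m + x $ n else x $ i)) = 1"
proof -
  have "matrix (\<lambda>x::real^'n. \<chi> i. if i = m then x $ m + x $ n else x $ i)
      = (\<chi> k. if k = m then row m (mat 1) + 1 *s row n (mat 1) else row k (mat 1 :: real^'n^'n))"
    by (auto simp: matrix_def row_def vec_eq_iff axis_def mat_def)
  then show ?thesis
    using det_row_operation[OF assms, of "mat 1 :: real^'n^'n" 1] by simp
qed

lemma measure_shear_box:
  fixes a b :: "real^'n"
  assumes "m \<noteq> n"
  shows "measure lebesgue ((\<lambda>x. \<chi> i. if i = m then x $ m + x $ n else x $ i) ` cbox a b)
       = measure lebesgue (cbox a b)"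
proof (cases "cbox a b = {}")
  case False
  define h :: "real^'n \<Rightarrow> real^'n" where "h = (\<lambda>x. \<chi> i. if i = m then x $ m + x $ n else x $ i)"
  \<comment> \<open>\<open>measure_shear_interval\<close> is about boxes with a nonnegative lower corner: move it to the origin.\<close>
  have hadd: "h (a + x) = h a + h x" for x
    by (auto simp: h_def vec_eq_iff)
  have box: "cbox a b = (+) a ` cbox 0 (b - a)"
    by (simp add: cbox_translation[symmetric])
  then have ne: "cbox 0 (b - a) \<noteq> {}"
    using False by auto
  have "h ` cbox a b = (+) (h a) ` h ` cbox 0 (b - a)"
    unfolding box image_image hadd ..
  then have "measure lebesgue (h ` cbox a b) = measure lebesgue (h ` cbox 0 (b - a))"
    by (simp only: measure_translation)
  also have "\<dots> = measure lebesgue (cbox 0 (b - a))"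
    unfolding h_def by (rule measure_shear_interval[OF assms ne]) simp
  also have "\<dots> = measure lebesgue (cbox a b)"
    unfolding box by (rule measure_translation[symmetric])
  finally show ?thesis
    by (simp add: h_def)
qed simp

lemma measure_coordinate_swap_box:
  fixes a b :: "real^'n"
  shows "measure lebesgue ((\<lambda>x. \<chi> i. x $ Transposition.transpose m n i) ` cbox a b)
       = measure lebesgue (cbox a b)"
proof -
  define h :: "real^'n \<Rightarrow> real^'n" where "h = (\<lambda>x. \<chi> i. x $ Transposition.transpose m n i)"
  have hh: "h (h x) = x" for x
    by (simp add: h_def vec_eq_iff)
  have mem: "h x \<in> cbox (h a) (h b) \<longleftrightarrow> x \<in> cbox a b" for x
    unfolding h_def mem_box_cart vec_lambda_beta by (metis transpose_involutory)
  have im: "h ` cbox a b = cbox (h a) (h b)"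
  proof (intro equalityI subsetI)
    fix y
    assume "y \<in> cbox (h a) (h b)"
    then show "y \<in> h ` cbox a b"
      using mem[of "h y"] hh[of y] by (metis imageI)
  qed (auto simp: mem)
  show ?thesis
  proof (cases "cbox a b = {}")
    case False
    then have "h ` cbox a b \<noteq> {}"
      by simp
    then have "cbox (h a) (h b) \<noteq> {}"
      using im by simp
    then have "measure lborel (cbox (h a) (h b)) = (\<Prod>i\<in>UNIV. h b $ i - h a $ i)"
      by (simp add: content_cbox_cart)
    also have "\<dots> = (\<Prod>i\<in>UNIV. b $ i - a $ i)"
      using prod.permute[OF permutes_swap_id[of m UNIV n], of "\<lambda>i. b $ i - a $ i"]
      by (simp add: h_def o_def)
    also have "\<dots> = measure lborel (cbox a b)"
      using False by (simp add: content_cbox_cart)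
    finally show ?thesis
      unfolding h_def[symmetric] im by simp
  qed simp
qed

lemma abs_det_matrix_coordinate_swap:
  "\<bar>det (matrix (\<lambda>x::real^'n. \<chi> i. x $ Transposition.transpose m n i))\<bar> = 1"
proof -
  let ?p = "Transposition.transpose m n"
  have "matrix (\<lambda>x::real^'n. \<chi> i. x $ ?p i) = (\<chi> i. (mat 1 :: real^'n^'n) $ ?p i)"
    by (auto simp: matrix_def vec_eq_iff axis_def mat_def)
  then show ?thesis
    using det_permute_rows[OF permutes_swap_id[of m UNIV n], of "mat 1 :: real^'n^'n"]
    by (simp add: sign_swap_id)
qed

text \<open>
  The statement is multiplicative in \<open>f\<close>, so it suffices to check it on elementary maps; for
  those of determinant \<open>1\<close> or \<open>- 1\<close> it suffices to look at boxes.
\<close>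
proposition linear_image_lebesgue:
  fixes f :: "real^'n \<Rightarrow> real^'n"
  assumes "linear f" and "S \<in> lmeasurable"
  shows "f ` S \<in> lmeasurable \<and> measure lebesgue (f ` S) = \<bar>det (matrix f)\<bar> * measure lebesgue S"
proof -
  define scales where "scales f \<longleftrightarrow> (\<forall>S\<in>lmeasurable. f ` S \<in> lmeasurable \<and>
      measure lebesgue (f ` S) = \<bar>det (matrix f)\<bar> * measure lebesgue S)"
    for f :: "real^'n \<Rightarrow> real^'n"
  have unit: "scales f"
    if "linear f" "\<bar>det (matrix f)\<bar> = 1"
       "\<And>a b. measure lebesgue (f ` cbox a b) = measure lebesgue (cbox a b)" for f
    unfolding scales_def
  proof
    fix S :: "(real^'n) set"
    assume "S \<in> lmeasurable"
    then have "f ` S \<in> lmeasurable \<and> 1 * measure lebesgue S = measure lebesgue (f ` S)"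
      by (rule measure_linear_sufficient[OF that(1)]) (simp only: that(3) mult_1)
    then show "f ` S \<in> lmeasurable \<and> measure lebesgue (f ` S) = \<bar>det (matrix f)\<bar> * measure lebesgue S"
      using that(2) by simp
  qed
  have "scales f"
  proof (rule induct_linear_elementary[OF \<open>linear f\<close>])
    fix f g :: "real^'n \<Rightarrow> real^'n"
    assume "linear f" "linear g" "scales f" "scales g"
    then show "scales (f \<circ> g)"
      unfolding scales_def image_comp[symmetric]
      by (simp add: matrix_compose det_mul abs_mult)
  next
    fix f :: "real^'n \<Rightarrow> real^'n" and i
    assume f: "linear f" and 0: "\<And>x. f x $ i = 0"
    have "\<not> surj f"
      by (metis 0 one_neq_zero surjE vec_component)
    then have "\<not> inj f"
      using f linear_injective_imp_surjective by blast
    then show "scales f"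
      using f det_nz_iff_inj[OF f] negligible_linear_singular_image[OF f]
      by (auto simp: scales_def negligible_iff_measure)
  next
    fix c :: "'n \<Rightarrow> real"
    have "matrix (\<lambda>x::real^'n. \<chi> i. c i * x $ i) $ i $ j = (if i = j then c i else 0)" for i j
      by (simp add: matrix_def axis_def)
    then have "det (matrix (\<lambda>x::real^'n. \<chi> i. c i * x $ i)) = prod c UNIV"
      by (subst det_diagonal) auto
    then show "scales (\<lambda>x. \<chi> i. c i * x $ i)"
      by (simp add: scales_def measurable_stretch measure_stretch)
  next
    fix m n :: 'n
    assume "m \<noteq> n"
    show "scales (\<lambda>x. \<chi> i. x $ Transposition.transpose m n i)"
      by (rule unit) (auto intro!: linearI simp: vec_eq_iff abs_det_matrix_coordinate_swap
          measure_coordinate_swap_box)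
    show "scales (\<lambda>x. \<chi> i. if i = m then x $ m + x $ n else x $ i)"
      by (rule unit) (use \<open>m \<noteq> n\<close> measure_shear_box[OF \<open>m \<noteq> n\<close>] in \<open>auto intro!: linearI simp: vec_eq_iff algebra_simps
          det_matrix_shear\<close>)
  qed
  then show ?thesis
    using assms(2) by (auto simp: scales_def)
qed

section \<open>Tilings and the index of a sublattice\<close>

text \<open>
  The translates of the tile \<open>D\<close> by \<open>K\<close> partition the whole group; for a lattice \<open>K\<close> the tile is
  a fundamental domain.
\<close>
definition tiles :: "'a::ab_group_add set \<Rightarrow> 'a set \<Rightarrow> bool" where
  "tiles K D \<longleftrightarrow> (\<forall>x. \<exists>!k. k \<in> K \<and> x - k \<in> D)"

text \<open>
  Cut \<open>D\<close> along the translates \<open>k + E\<close> and move each piece back by \<open>k\<close>: the result is \<open>E\<close>, cut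
  along the translates \<open>- k + D\<close>.
\<close>
lemma tiles_equal_measure:
  fixes K D E :: "'a::euclidean_space set"
  assumes K: "countable K" "\<And>k. k \<in> K \<Longrightarrow> - k \<in> K"
    and D: "tiles K D" "D \<in> sets lebesgue" and E: "tiles K E" "E \<in> sets lebesgue"
  shows "emeasure lebesgue D = emeasure lebesgue E"
proof -
  have mem: "x \<in> (+) k ` Y \<longleftrightarrow> x - k \<in> Y" for x k :: 'a and Y
    by (metis add_diff_cancel_left' diff_add_cancel add.commute image_iff)
  have pieces: "emeasure lebesgue X = (\<integral>\<^sup>+k. emeasure lebesgue (X \<inter> (+) k ` Y) \<partial>count_space K)"
    if X: "X \<in> sets lebesgue" and Y: "tiles K Y" "Y \<in> sets lebesgue" for X Y :: "'a set"
  proof -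
    have "X = (\<Union>k\<in>K. X \<inter> (+) k ` Y)"
      using Y(1) unfolding tiles_def by (auto simp: mem) metis
    moreover have "disjoint_family_on (\<lambda>k. X \<inter> (+) k ` Y) K"
      using Y(1) unfolding tiles_def disjoint_family_on_def by (simp add: set_eq_iff mem) blast
    moreover have "(+) k ` Y \<in> sets lebesgue" for k
      using Y(2) by (rule lebesgue_sets_translation)
    ultimately show ?thesis
      using emeasure_UN_countable[of K "\<lambda>k. X \<inter> (+) k ` Y" lebesgue] K(1) X
      by (metis (no_types, lifting) sets.Int)
  qed
  have "emeasure lebesgue (D \<inter> (+) k ` E) = emeasure lebesgue (E \<inter> (+) (- k) ` D)" for k
  proof -
    have "D \<inter> (+) k ` E = (+) k ` (E \<inter> (+) (- k) ` D)"
      by (auto simp: set_eq_iff mem)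
    then show ?thesis
      using emeasure_lebesgue_affine[of 1 k "E \<inter> (+) (- k) ` D"] by (simp add: add.commute cong: image_cong_simp)
  qed
  then have "emeasure lebesgue D
      = (\<integral>\<^sup>+k. emeasure lebesgue (E \<inter> (+) (- k) ` D) \<partial>count_space K)"
    using pieces[OF D(2) E] by simp
  also have "\<dots> = (\<integral>\<^sup>+k. emeasure lebesgue (E \<inter> (+) k ` D) \<partial>count_space K)"
    by (rule nn_integral_bij_count_space[of uminus K K])
       (use K(2) in \<open>auto intro!: bij_betw_byWitness[where f' = uminus]\<close>)
  also have "\<dots> = emeasure lebesgue E"
    using pieces[OF E(2) D] by simp
  finally show ?thesis .
qed

definition half_open_cube :: "(real^'n) set" where
  "half_open_cube = {x. \<forall>i. 0 \<le> x $ i \<and> x $ i < 1}"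

lemma int_lattice_closed:
  shows int_lattice_0: "0 \<in> int_lattice"
    and int_lattice_add: "x \<in> int_lattice \<Longrightarrow> y \<in> int_lattice \<Longrightarrow> x + y \<in> int_lattice"
    and int_lattice_diff: "x \<in> int_lattice \<Longrightarrow> y \<in> int_lattice \<Longrightarrow> x - y \<in> int_lattice"
    and int_lattice_uminus: "x \<in> int_lattice \<Longrightarrow> - x \<in> int_lattice"
    and int_lattice_scaleR: "c \<in> \<int> \<Longrightarrow> x \<in> int_lattice \<Longrightarrow> c *\<^sub>R x \<in> int_lattice"
    and int_lattice_axis: "axis a 1 \<in> int_lattice"
  by (auto simp: int_lattice_def axis_def)

lemma int_lattice_sum:
  "(\<And>a. a \<in> S \<Longrightarrow> x a \<in> int_lattice) \<Longrightarrow> sum x S \<in> int_lattice"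
  by (induction S rule: infinite_finite_induct) (auto simp: int_lattice_closed)

lemma countable_int_lattice: "countable (int_lattice :: (real^'n) set)"
proof -
  have "int_lattice \<subseteq> (\<lambda>z::int^'n. \<chi> i. real_of_int (z $ i)) ` UNIV"
  proof
    fix x :: "real^'n"
    assume "x \<in> int_lattice"
    then have "x = (\<chi> i. real_of_int ((\<chi> j. \<lfloor>x $ j\<rfloor>) $ i))"
      by (simp add: int_lattice_def vec_eq_iff)
    then show "x \<in> (\<lambda>z::int^'n. \<chi> i. real_of_int (z $ i)) ` UNIV"
      by blast
  qed
  moreover have "countable (UNIV :: (int^'n) set)"
  proof -
    have "inj (\<lambda>z::int^'n. ($) z)"
      by (simp add: inj_def vec_eq_iff fun_eq_iff)
    moreover have "countable (UNIV :: ('n \<Rightarrow> int) set)"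
      by simp
    ultimately show ?thesis
      by (metis countable_image_inj_on countable_subset subset_UNIV)
  qed
  ultimately show ?thesis
    by (meson countable_image countable_subset)
qed

lemma half_open_cube_measure:
  "(half_open_cube :: (real^'n) set) \<in> lmeasurable" "measure lebesgue (half_open_cube :: (real^'n) set) = 1"
proof -
  have sub: "box 0 1 \<subseteq> half_open_cube" "half_open_cube \<subseteq> cbox 0 (1::real^'n)"
    by (auto simp: half_open_cube_def mem_box_cart less_imp_le)
  have int: "half_open_cube = (\<Inter>i\<in>UNIV. {x::real^'n. 0 \<le> x $ i} \<inter> {x. x $ i < 1})"
    by (auto simp: half_open_cube_def)
  have "{x::real^'n. 0 \<le> x $ i} \<in> sets borel" "{x::real^'n. x $ i < 1} \<in> sets borel" for i
    by (auto intro!: borel_closed borel_open closed_halfspace_component_ge_cart open_halfspace_component_lt_cart)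
  then have "half_open_cube \<in> sets (borel :: (real^'n) measure)"
    unfolding int by (intro sets.finite_INT sets.Int) auto
  then show m: "(half_open_cube :: (real^'n) set) \<in> lmeasurable"
    using bounded_set_imp_lmeasurable[OF bounded_subset[OF bounded_cbox sub(2)]]
    by (simp add: sets_completionI_sets)
  have "(1::real^'n) \<bullet> b = 1" if "b \<in> Basis" for b
    using that by (auto simp: Basis_vec_def inner_axis)
  then have "measure lebesgue (box 0 (1::real^'n)) = 1" "measure lebesgue (cbox 0 (1::real^'n)) = 1"
    by (simp_all add: measure_lborel_box_eq measure_lborel_cbox_eq)
  then show "measure lebesgue (half_open_cube :: (real^'n) set) = 1"
    using measure_mono_fmeasurable[OF sub(1) _ m] measure_mono_fmeasurable[OF sub(2), of lebesgue] m
    by (auto simp: fmeasurableD)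
qed

lemma tiles_half_open_cube: "tiles int_lattice half_open_cube"
  unfolding tiles_def
proof (intro allI ex_ex1I)
  fix x :: "real^'n"
  show "\<exists>k. k \<in> int_lattice \<and> x - k \<in> half_open_cube"
    by (rule exI[of _ "\<chi> i. real_of_int \<lfloor>x $ i\<rfloor>"])
       (auto simp: int_lattice_def half_open_cube_def, linarith)
next
  fix x k l :: "real^'n"
  assume "k \<in> int_lattice \<and> x - k \<in> half_open_cube" "l \<in> int_lattice \<and> x - l \<in> half_open_cube"
  then have kl: "k \<in> int_lattice" "l \<in> int_lattice" "x - k \<in> half_open_cube" "x - l \<in> half_open_cube"
    by auto
  have "k $ i = l $ i" for i
  proof -
    obtain a b :: int where "k $ i = a" "l $ i = b"
      using kl(1,2) by (auto simp: int_lattice_def elim!: Ints_cases) (metis Ints_cases)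
    moreover have "0 \<le> x $ i - k $ i" "x $ i - k $ i < 1" "0 \<le> x $ i - l $ i" "x $ i - l $ i < 1"
      using kl(3,4) by (auto simp: half_open_cube_def)
    ultimately have "a = b"
      by linarith
    then show ?thesis
      using \<open>k $ i = a\<close> \<open>l $ i = b\<close> by simp
  qed
  then show "k = l"
    by (simp add: vec_eq_iff)
qed

lemma tiles_linear_image:
  assumes "linear f" "bij f" "tiles K D"
  shows "tiles (f ` K) (f ` D)"
  unfolding tiles_def
proof
  fix x
  obtain y where y: "x = f y"
    using \<open>bij f\<close> by (metis bij_pointE)
  obtain k where k: "k \<in> K" "y - k \<in> D" and uniq: "\<And>l. l \<in> K \<Longrightarrow> y - l \<in> D \<Longrightarrow> l = k"
    using \<open>tiles K D\<close> unfolding tiles_def by metis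
  have fD: "f a - f b \<in> f ` D \<longleftrightarrow> a - b \<in> D" for a b
    using assms(1,2) by (metis bij_def inj_image_mem_iff linear_diff)
  show "\<exists>!k. k \<in> f ` K \<and> x - k \<in> f ` D"
  proof (rule ex1I[of _ "f k"])
    show "f k \<in> f ` K \<and> x - f k \<in> f ` D"
      using k by (simp add: y fD)
  next
    fix l
    assume "l \<in> f ` K \<and> x - l \<in> f ` D"
    then obtain m where "m \<in> K" "l = f m" "f y - f m \<in> f ` D"
      by (auto simp: y)
    then show "l = f k"
      using uniq[of m] by (simp add: fD)
  qed
qed

lemma linear_vec_expansion:
  fixes f :: "real^'n \<Rightarrow> 'b::real_vector"
  assumes "linear f"
  shows "f x = (\<Sum>a\<in>UNIV. x $ a *\<^sub>R f (axis a 1))"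
proof -
  have "f x = f (\<Sum>a\<in>UNIV. x $ a *\<^sub>R axis a 1)"
    by (simp add: basis_expansion scalar_mult_eq_scaleR[symmetric])
  also have "\<dots> = (\<Sum>a\<in>UNIV. x $ a *\<^sub>R f (axis a 1))"
    by (simp add: linear_sum[OF assms] linear_cmul[OF assms])
  finally show ?thesis .
qed

lemma linear_image_int_lattice_subset:
  fixes f :: "real^'n \<Rightarrow> real^'n"
  assumes "linear f" "\<And>a. f (axis a 1) \<in> int_lattice"
  shows "f ` int_lattice \<subseteq> int_lattice"
proof
  fix y
  assume "y \<in> f ` int_lattice"
  then obtain x where x: "x \<in> int_lattice" "y = f x"
    by blast
  then show "y \<in> int_lattice"
    using assms(2) unfolding x(2) linear_vec_expansion[OF assms(1), of x]
    by (intro int_lattice_sum int_lattice_scaleR) (auto simp: int_lattice_def)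
qed

lemma int_lattice_group_simps [simp]:
  "carrier int_lattice_group = int_lattice"
  "x \<otimes>\<^bsub>int_lattice_group\<^esub> y = x + y"
  "\<one>\<^bsub>int_lattice_group\<^esub> = 0"
  by (simp_all add: int_lattice_group_def)

lemma group_int_lattice: "group (int_lattice_group :: (real^'n) monoid)"
proof (rule groupI)
  fix x :: "real^'n"
  assume "x \<in> carrier int_lattice_group"
  then show "\<exists>y\<in>carrier int_lattice_group. y \<otimes>\<^bsub>int_lattice_group\<^esub> x = \<one>\<^bsub>int_lattice_group\<^esub>"
    by (intro bexI[of _ "- x"]) (auto simp: int_lattice_closed)
qed (auto simp: int_lattice_closed add.assoc)

lemma inv_int_lattice_group [simp]:
  "x \<in> int_lattice \<Longrightarrow> inv\<^bsub>int_lattice_group\<^esub> x = - x"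
  by (rule group.inv_equality[OF group_int_lattice]) (auto simp: int_lattice_closed)

lemma subgroup_linear_image:
  assumes "linear f" "f ` int_lattice \<subseteq> int_lattice"
  shows "subgroup (f ` int_lattice) int_lattice_group"
proof (rule group.subgroupI[OF group_int_lattice])
  fix a
  assume "a \<in> f ` int_lattice"
  then obtain x where "x \<in> int_lattice" "a = f x"
    by blast
  then show "inv\<^bsub>int_lattice_group\<^esub> a \<in> f ` int_lattice"
    using assms by (auto simp: linear_neg[symmetric] image_subset_iff int_lattice_uminus)
next
  fix a b
  assume "a \<in> f ` int_lattice" "b \<in> f ` int_lattice"
  then show "a \<otimes>\<^bsub>int_lattice_group\<^esub> b \<in> f ` int_lattice"
    using assms(1) by (auto simp: linear_add[symmetric] int_lattice_add)
qed (use assms int_lattice_0 in auto)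

lemma generate_linear_image:
  fixes f :: "real^'n \<Rightarrow> real^'n"
  assumes f: "linear f" and axes: "\<And>a. f (axis a 1) \<in> int_lattice"
  shows "generate int_lattice_group (range (\<lambda>a. f (axis a 1))) = f ` int_lattice"
proof
  have "subgroup (f ` int_lattice) int_lattice_group"
    by (intro subgroup_linear_image linear_image_int_lattice_subset assms)
  then show "generate int_lattice_group (range (\<lambda>a. f (axis a 1))) \<subseteq> f ` int_lattice"
    by (intro group.generate_subgroup_incl[OF group_int_lattice]) (auto simp: int_lattice_axis)
next
  define K where "K = generate int_lattice_group (range (\<lambda>a. f (axis a 1)))"
  have sub: "subgroup K int_lattice_group"
    unfolding K_def using axes by (intro group.generate_is_subgroup[OF group_int_lattice]) auto
  have K0: "0 \<in> K" and Kadd: "x \<in> K \<Longrightarrow> y \<in> K \<Longrightarrow> x + y \<in> K" for x y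
    using subgroup.one_closed[OF sub] subgroup.m_closed[OF sub] by auto
  have Kminus: "- x \<in> K" if "x \<in> K" for x
    using subgroup.m_inv_closed[OF sub that] subgroup.mem_carrier[OF sub that] by simp
  have Kint: "real_of_int m *\<^sub>R x \<in> K" if "x \<in> K" for m x
  proof (induction m rule: int_induct[of _ 0])
    case (step1 m)
    then show ?case
      using Kadd[OF _ \<open>x \<in> K\<close>] by (simp add: scaleR_add_left)
  next
    case (step2 m)
    then show ?case
      using Kadd[OF _ Kminus[OF \<open>x \<in> K\<close>]] by (auto simp: scaleR_diff_left)
  qed (simp add: K0)
  have Ksum: "(\<And>a. a \<in> S \<Longrightarrow> g a \<in> K) \<Longrightarrow> sum g S \<in> K" for g :: "'n \<Rightarrow> real^'n" and S
    by (induction S rule: infinite_finite_induct) (auto simp: K0 Kadd)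
  show "f ` int_lattice \<subseteq> K"
  proof
    fix y
    assume "y \<in> f ` int_lattice"
    then obtain x where x: "x \<in> int_lattice" "y = f x"
      by blast
    have "x $ a *\<^sub>R f (axis a 1) \<in> K" for a
    proof -
      obtain m where "x $ a = real_of_int m"
        using x(1) by (auto simp: int_lattice_def elim: Ints_cases)
      moreover have "f (axis a 1) \<in> K"
        unfolding K_def by (rule generate.incl) simp
      ultimately show ?thesis
        using Kint by simp
    qed
    then show "y \<in> K"
      unfolding x(2) linear_vec_expansion[OF f, of x] by (intro Ksum)
  qed
qed

text \<open>
  A tile contains exactly one element of each coset, which turns the counting of cosets into the
  counting of lattice points.
\<close>
lemma bij_betw_rcosets:
  assumes sub: "subgroup L int_lattice_group" and til: "tiles L D"
  shows "bij_betw (\<lambda>r. L #>\<^bsub>int_lattice_group\<^esub> r) (D \<inter> int_lattice) (rcosets\<^bsub>int_lattice_group\<^esub> L)"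
proof -
  have L0: "0 \<in> L" and Ladd: "x \<in> L \<Longrightarrow> y \<in> L \<Longrightarrow> x + y \<in> L"
    and Lsub: "x \<in> L \<Longrightarrow> x \<in> int_lattice" for x y
    using subgroup.one_closed[OF sub] subgroup.m_closed[OF sub] subgroup.subset[OF sub] by auto
  have Lminus: "- x \<in> L" if "x \<in> L" for x
    using subgroup.m_inv_closed[OF sub that] Lsub[OF that] by simp
  have coset: "L #>\<^bsub>int_lattice_group\<^esub> r = (\<lambda>l. l + r) ` L" for r
    by (auto simp: r_coset_def)
  have "inj_on (\<lambda>r. (\<lambda>l. l + r) ` L) (D \<inter> int_lattice)"
  proof (rule inj_onI)
    fix r s
    assume r: "r \<in> D \<inter> int_lattice" and s: "s \<in> D \<inter> int_lattice"
      and eq: "(\<lambda>l. l + r) ` L = (\<lambda>l. l + s) ` L"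
    have "r \<in> (\<lambda>l. l + r) ` L"
      using L0 by (auto simp: image_iff)
    then obtain l where l: "l \<in> L" "r = l + s"
      unfolding eq by blast
    have "l = 0"
      using til[unfolded tiles_def, rule_format, of r] l L0 r s by auto
    then show "r = s"
      using l by simp
  qed
  moreover have "(\<lambda>r. (\<lambda>l. l + r) ` L) ` (D \<inter> int_lattice) = (\<lambda>r. (\<lambda>l. l + r) ` L) ` int_lattice"
  proof (intro equalityI subsetI)
    fix X
    assume "X \<in> (\<lambda>r. (\<lambda>l. l + r) ` L) ` int_lattice"
    then obtain x where x: "x \<in> int_lattice" "X = (\<lambda>l. l + x) ` L"
      by blast
    obtain l where l: "l \<in> L" "x - l \<in> D"
      using til unfolding tiles_def by blast
    have "(\<lambda>l. l + x) ` L = (\<lambda>k. k + (x - l)) ` L"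
    proof (intro equalityI subsetI)
      fix y
      assume "y \<in> (\<lambda>l. l + x) ` L"
      then obtain k where "k \<in> L" "y = k + x"
        by blast
      then show "y \<in> (\<lambda>k. k + (x - l)) ` L"
        using Ladd[of k l] l by (intro image_eqI[of _ _ "k + l"]) auto
    next
      fix y
      assume "y \<in> (\<lambda>k. k + (x - l)) ` L"
      then obtain k where "k \<in> L" "y = k + (x - l)"
        by blast
      then show "y \<in> (\<lambda>l. l + x) ` L"
        using Ladd[of k "- l"] Lminus l by (intro image_eqI[of _ _ "k - l"]) auto
    qed
    then show "X \<in> (\<lambda>r. (\<lambda>l. l + r) ` L) ` (D \<inter> int_lattice)"
      using x l Lsub int_lattice_diff by blast
  qed auto
  ultimately show ?thesis
    unfolding bij_betw_def coset RCOSETS_def by (simp add: image_def) blast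
qed

text \<open>
  To move a point into the union, first round it down to a lattice point \<open>m\<close>, and then move \<open>m\<close> into
  the tile \<open>D\<close> by an element of \<open>L\<close>.
\<close>
lemma tiles_Union_cubes:
  fixes L D :: "(real^'n) set"
  assumes L: "L \<subseteq> int_lattice" and D: "tiles L D"
  shows "tiles L (\<Union>r\<in>D \<inter> int_lattice. (+) r ` half_open_cube)"
  unfolding tiles_def
proof
  fix x :: "real^'n"
  have mem: "y \<in> (\<Union>r\<in>D \<inter> int_lattice. (+) r ` half_open_cube)
      \<longleftrightarrow> (\<exists>r\<in>D \<inter> int_lattice. y - r \<in> half_open_cube)" for y
    by (force simp: image_iff algebra_simps)
  obtain m where m: "m \<in> int_lattice" "x - m \<in> half_open_cube"
    and m_unique: "\<And>k. k \<in> int_lattice \<Longrightarrow> x - k \<in> half_open_cube \<Longrightarrow> k = m"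
    using tiles_half_open_cube unfolding tiles_def by metis
  obtain l where l: "l \<in> L" "m - l \<in> D" and l_unique: "\<And>k. k \<in> L \<Longrightarrow> m - k \<in> D \<Longrightarrow> k = l"
    using D unfolding tiles_def by metis
  show "\<exists>!k. k \<in> L \<and> x - k \<in> (\<Union>r\<in>D \<inter> int_lattice. (+) r ` half_open_cube)"
    unfolding mem
  proof (rule ex1I[of _ l])
    have "m - l \<in> int_lattice"
      using L l m int_lattice_diff by blast
    then show "l \<in> L \<and> (\<exists>r\<in>D \<inter> int_lattice. x - l - r \<in> half_open_cube)"
      using l m by (intro conjI bexI[of _ "m - l"]) auto
  next
    fix k
    assume "k \<in> L \<and> (\<exists>r\<in>D \<inter> int_lattice. x - k - r \<in> half_open_cube)"
    then obtain r where kr: "k \<in> L" "r \<in> D" "r \<in> int_lattice" "x - (k + r) \<in> half_open_cube"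
      by (auto simp: diff_diff_eq)
    then have "k + r = m"
      using L int_lattice_add by (intro m_unique) blast+
    then show "k = l"
      using kr by (intro l_unique) auto
  qed
qed

text \<open>
  Both the parallelepiped \<open>D\<close> and the union \<open>E\<close> of the unit cubes at its lattice points tile space
  under the sublattice. The former has measure \<open>\<bar>det (matrix f)\<bar>\<close>, the latter the number of lattice
  points in \<open>D\<close>, that is, of cosets. Comparing the measures also shows that this number is finite.
\<close>
proposition sublattice_index_eq_det:
  fixes f :: "real^'n \<Rightarrow> real^'n"
  assumes f: "linear f" "inj f" and axes: "\<And>a. f (axis a 1) \<in> int_lattice"
  shows "real (sublattice_index (range (\<lambda>a. f (axis a 1)))) = \<bar>det (matrix f)\<bar>"
proof -
  define L where "L = f ` int_lattice"
  define D where "D = f ` half_open_cube"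
  have bij: "bij f"
    using f linear_injective_imp_surjective unfolding bij_def by blast
  have Lsub: "L \<subseteq> int_lattice"
    unfolding L_def by (rule linear_image_int_lattice_subset[OF f(1) axes])
  have D: "tiles L D"
    unfolding L_def D_def by (intro tiles_linear_image f bij tiles_half_open_cube)
  have lD: "D \<in> lmeasurable" and mD: "measure lebesgue D = \<bar>det (matrix f)\<bar>"
    using linear_image_lebesgue[OF f(1) half_open_cube_measure(1)]
    by (auto simp: D_def half_open_cube_measure)
  define R where "R = D \<inter> int_lattice"
  define E where "E = (\<Union>r\<in>R. (+) r ` (half_open_cube :: (real^'n) set))"
  have R: "countable R"
    unfolding R_def using countable_int_lattice by blast
  have cube: "(+) r ` half_open_cube \<in> sets lebesgue"
      "emeasure lebesgue ((+) r ` half_open_cube) = 1" for r :: "real^'n"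
  proof -
    have "(+) r ` half_open_cube \<in> lmeasurable"
      by (intro measurable_translation half_open_cube_measure)
    then show "(+) r ` half_open_cube \<in> sets lebesgue"
        "emeasure lebesgue ((+) r ` half_open_cube) = 1"
      by (auto simp: emeasure_eq_measure2 measure_translation half_open_cube_measure)
  qed
  have E: "tiles L E" "E \<in> sets lebesgue"
    using tiles_Union_cubes[OF Lsub D] cube(1) R
    by (auto simp: E_def R_def intro!: sets.countable_UN'')
  have "disjoint_family_on (\<lambda>r. (+) r ` half_open_cube) R"
    unfolding disjoint_family_on_def
  proof (intro ballI impI equals0I)
    fix r s x
    assume rs: "r \<in> R" "s \<in> R" "r \<noteq> s" and x: "x \<in> (+) r ` half_open_cube \<inter> (+) s ` half_open_cube"
    have "x - r \<in> half_open_cube" "x - s \<in> half_open_cube"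
      using IntD1[OF x] IntD2[OF x] by (metis add_diff_cancel_left' imageE)+
    then show False
      using tiles_half_open_cube rs unfolding tiles_def R_def by blast
  qed
  then have "emeasure lebesgue E = (\<integral>\<^sup>+r. 1 \<partial>count_space R)"
    using emeasure_UN_countable[of R "\<lambda>r. (+) r ` half_open_cube" lebesgue] R cube
    by (simp add: E_def)
  also have "\<dots> = emeasure (count_space R) R"
    by simp
  finally have "emeasure (count_space R) R = emeasure lebesgue E" ..
  also have "\<dots> = emeasure lebesgue D"
  proof (rule tiles_equal_measure)
    show "countable L"
      using countable_subset[OF Lsub] countable_int_lattice .
    show "- k \<in> L" if "k \<in> L" for k
      using that by (auto simp: L_def linear_neg[OF f(1), symmetric] int_lattice_uminus)
  qed (use D E lD in auto)
  also have "\<dots> = ennreal \<bar>det (matrix f)\<bar>"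
    using lD mD by (simp add: emeasure_eq_measure2)
  finally have eq: "emeasure (count_space R) R = ennreal \<bar>det (matrix f)\<bar>" .
  then have "finite R"
    by (metis emeasure_count_space_infinite ennreal_neq_top order_refl infinity_ennreal_def)
  then have "real (card R) = \<bar>det (matrix f)\<bar>"
    using eq by (simp add: emeasure_count_space_finite ennreal_of_nat_eq_real_of_nat)
  moreover have "generate int_lattice_group (range (\<lambda>a. f (axis a 1))) = L"
    unfolding L_def by (rule generate_linear_image[OF f(1) axes])
  moreover have "card R = card (rcosets\<^bsub>int_lattice_group\<^esub> L)"
    unfolding R_def using Lsub
    by (intro bij_betw_same_card[OF bij_betw_rcosets] D)
       (auto simp: L_def intro: subgroup_linear_image f)
  ultimately show ?thesis
    by (simp add: sublattice_index_def)
qed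

lemma unimodular_map_inj:
  fixes f :: "real^'n \<Rightarrow> real^'n"
  assumes f: "linear f" and onto: "f ` int_lattice = int_lattice"
  shows "inj f"
proof -
  have "axis a 1 \<in> range f" for a
    using int_lattice_axis onto by blast
  then have "(\<Sum>a\<in>UNIV. x $ a *s axis a 1) \<in> range f" for x
    unfolding scalar_mult_eq_scaleR
    by (intro subspace_sum subspace_scale linear_subspace_image f subspace_UNIV)
  then have "surj f"
    unfolding basis_expansion by blast
  then show ?thesis
    using f linear_surjective_imp_injective by blast
qed

text \<open>
  The unit cube and its image under \<open>f\<close> tile space under the same lattice.
\<close>
lemma abs_det_lattice_automorphism:
  fixes f :: "real^'n \<Rightarrow> real^'n"
  assumes f: "linear f" "inj f" and onto: "f ` int_lattice = int_lattice"
  shows "\<bar>det (matrix f)\<bar> = 1"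
proof -
  let ?D = "f ` half_open_cube"
  have bij: "bij f"
    using f linear_injective_imp_surjective unfolding bij_def by blast
  have "tiles int_lattice ?D"
    using tiles_linear_image[OF f(1) bij tiles_half_open_cube] onto by simp
  then have "emeasure lebesgue ?D = emeasure lebesgue (half_open_cube :: (real^'n) set)"
    using linear_image_lebesgue[OF f(1) half_open_cube_measure(1)] half_open_cube_measure(1)
    by (intro tiles_equal_measure[of int_lattice] countable_int_lattice tiles_half_open_cube)
       (auto simp: int_lattice_uminus)
  then show ?thesis
    using linear_image_lebesgue[OF f(1) half_open_cube_measure(1)]
    by (simp add: measure_def[of lebesgue "?D"] half_open_cube_measure flip: measure_def)
qed

section \<open>Facet indices as determinants\<close>

text \<open>
  The map sending the standard basis to the vertices \<open>v (e a)\<close> of a facet, where the enumeration \<open>e\<close>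
  matches the coordinates with the \<open>n\<close> labels of these vertices. Its image of the integer lattice is
  the sublattice spanned by the facet.
\<close>
definition facet_map :: "(nat \<Rightarrow> real^'n) \<Rightarrow> ('n \<Rightarrow> nat) \<Rightarrow> real^'n \<Rightarrow> real^'n" where
  "facet_map v e x = (\<Sum>a\<in>UNIV. x $ a *\<^sub>R v (e a))"

lemma linear_facet_map: "linear (facet_map v e)"
  unfolding facet_map_def
  by (rule linearI) (simp_all add: scaleR_add_left sum.distrib scaleR_sum_right)

lemma facet_map_axis: "facet_map v e (axis a 1) = v (e a)"
proof -
  have "(\<Sum>c\<in>UNIV. axis a 1 $ c *\<^sub>R v (e c)) = (\<Sum>c\<in>UNIV. if c = a then v (e c) else 0)"
    by (rule sum.cong) (auto simp: axis_def)
  then show ?thesis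
    by (simp add: facet_map_def)
qed

lemma matrix_facet_map: "matrix (facet_map v e) $ r $ a = v (e a) $ r"
  by (simp add: matrix_def facet_map_axis)

lemma facet_map_eq_sum:
  fixes v :: "nat \<Rightarrow> real^'n"
  assumes "bij_betw e UNIV I"
  shows "facet_map v e (\<chi> a. c (e a)) = (\<Sum>l\<in>I. c l *\<^sub>R v l)"
  unfolding facet_map_def using sum.reindex_bij_betw[OF assms, of "\<lambda>l. c l *\<^sub>R v l"] by simp

lemma facet_enumeration:
  assumes "i \<le> CARD('n)"
  obtains e :: "'n::finite \<Rightarrow> nat" where "bij_betw e UNIV ({..CARD('n)} - {i})"
proof -
  have "card ({..CARD('n)} - {i}) = CARD('n)"
    using assms by simp
  then show ?thesis
    using finite_same_card_bij[of "UNIV :: 'n set" "{..CARD('n)} - {i}"] that by auto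
qed

lemma facet_index_eq_det:
  fixes v :: "nat \<Rightarrow> real^'n"
  assumes e: "bij_betw e UNIV ({..CARD('n)} - {i})" and inj: "inj (facet_map v e)"
    and lat: "\<And>l. l \<le> CARD('n) \<Longrightarrow> l \<noteq> i \<Longrightarrow> v l \<in> int_lattice"
  shows "real (facet_index v i) = \<bar>det (matrix (facet_map v e))\<bar>"
proof -
  have e_in: "e a \<le> CARD('n)" "e a \<noteq> i" for a
    using bij_betw_imp_surj_on[OF e] by auto
  have "v ` ({..CARD('n)} - {i}) = range (\<lambda>a. facet_map v e (axis a 1))"
    unfolding facet_map_axis bij_betw_imp_surj_on[OF e, symmetric] by (simp add: image_image)
  moreover have "facet_map v e (axis a 1) \<in> int_lattice" for a
    by (simp add: facet_map_axis lat e_in)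
  ultimately show ?thesis
    unfolding facet_index_def using sublattice_index_eq_det[OF linear_facet_map inj] by simp
qed

text \<open>
  Cramer's rule: relabelling \<open>a\<close> exchanges one column of the matrix of a facet for \<open>v i\<close>, and this
  leads to the matrix of another facet.
\<close>
lemma det_facet_map_swap:
  fixes v :: "nat \<Rightarrow> real^'n"
  assumes "v i = facet_map v e x"
  shows "det (matrix (facet_map v (e(a := i)))) = x $ a * det (matrix (facet_map v e))"
proof -
  let ?A = "matrix (facet_map v e)"
  have "?A *v x = v i"
    using assms linear_facet_map by (metis matrix_vector_mul(2))
  then have "matrix (facet_map v (e(a := i)))
      = (\<chi> r c. if c = a then (?A *v x) $ r else ?A $ r $ c)"
    by (simp add: vec_eq_iff matrix_facet_map)
  then show ?thesis
    by (simp add: cramer_lemma)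
qed

text \<open>
  Only the lines spanned by the vertices have to correspond under \<open>T\<close>; scaling a vertex scales the
  indices of the facets that contain it. This is what makes the facet indices of a mutation
  computable, since its new vertex is a multiple of the image of the old one.
\<close>
lemma facet_index_transform:
  fixes v z :: "nat \<Rightarrow> real^'n"
  assumes e: "bij_betw e UNIV ({..CARD('n)} - {i})" and inj: "inj (facet_map v e)"
    and lat: "\<And>l. l \<le> CARD('n) \<Longrightarrow> v l \<in> int_lattice" "\<And>l. l \<le> CARD('n) \<Longrightarrow> z l \<in> int_lattice"
    and T: "linear T" "inj T"
    and z: "\<And>l. l \<le> CARD('n) \<Longrightarrow> z l = c l *\<^sub>R T (v l)" and c: "\<And>l. l \<le> CARD('n) \<Longrightarrow> c l \<noteq> 0"
  shows "real (facet_index z i)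
    = \<bar>det (matrix T)\<bar> * (\<Prod>l\<in>{..CARD('n)} - {i}. \<bar>c l\<bar>) * real (facet_index v i)"
proof -
  define D :: "real^'n \<Rightarrow> real^'n" where "D = (\<lambda>x. \<chi> a. c (e a) * x $ a)"
  have e_in: "e a \<le> CARD('n)" for a
    using bij_betw_imp_surj_on[OF e] by auto
  have lin: "linear D" "linear (facet_map v e)" "linear (T \<circ> facet_map v e)"
    by (auto intro!: linearI linear_compose linear_facet_map T simp: D_def vec_eq_iff algebra_simps)
  have "matrix D $ a $ b = (if a = b then c (e a) else 0)" for a b
    by (simp add: D_def matrix_def axis_def)
  then have "det (matrix D) = (\<Prod>a\<in>UNIV. c (e a))"
    by (subst det_diagonal) auto
  also have "\<dots> = (\<Prod>l\<in>{..CARD('n)} - {i}. c l)"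
    by (rule prod.reindex_bij_betw[OF e])
  finally have detD: "\<bar>det (matrix D)\<bar> = (\<Prod>l\<in>{..CARD('n)} - {i}. \<bar>c l\<bar>)"
    by (simp add: abs_prod)
  have comp: "facet_map z e = (T \<circ> facet_map v e) \<circ> D"
  proof
    fix x
    show "facet_map z e x = ((T \<circ> facet_map v e) \<circ> D) x"
      by (simp add: facet_map_def D_def linear_sum[OF T(1)] linear_cmul[OF T(1)] z e_in mult.commute)
  qed
  have "inj D"
    using c e_in by (auto simp: inj_def D_def vec_eq_iff)
  then have "inj (facet_map z e)"
    unfolding comp by (intro inj_compose T inj)
  then have "real (facet_index z i) = \<bar>det (matrix (facet_map z e))\<bar>"
    using lat by (intro facet_index_eq_det[OF e])
  also have "matrix (facet_map z e) = matrix T ** matrix (facet_map v e) ** matrix D"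
    unfolding comp using lin T by (simp add: matrix_compose)
  finally show ?thesis
    using facet_index_eq_det[OF e inj] lat by (simp add: det_mul abs_mult detD)
qed

section \<open>Multiplicity and weights\<close>

text \<open>
  If \<open>q\<close> divides all coefficients but that of \<open>v i\<close>, then \<open>\<mu> i *\<^sub>R v i\<close> is \<open>q\<close> times a lattice
  vector; as \<open>q\<close> is coprime to \<open>\<mu> i\<close>, so is \<open>v i\<close> itself, which is primitive.
\<close>
lemma Gcd_omit_primitive:
  fixes \<mu> :: "nat \<Rightarrow> nat" and v :: "nat \<Rightarrow> real^'n"
  assumes I: "finite I" "i \<in> I" and gcd: "Gcd (\<mu> ` I) = 1"
    and rel: "(\<Sum>l\<in>I. real (\<mu> l) *\<^sub>R v l) = 0"
    and lat: "\<And>l. l \<in> I \<Longrightarrow> v l \<in> int_lattice" and prim: "primitive (v i)"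
  shows "Gcd (\<mu> ` (I - {i})) = 1"
proof -
  define q where "q = Gcd (\<mu> ` (I - {i}))"
  have q_dvd: "q dvd \<mu> l" if "l \<in> I" "l \<noteq> i" for l
    unfolding q_def using that by (intro Gcd_dvd) auto
  have "\<mu> ` I = insert (\<mu> i) (\<mu> ` (I - {i}))"
    using I by blast
  then have "gcd (\<mu> i) q = 1"
    using gcd by (simp add: q_def)
  then obtain \<alpha> \<beta> where bezout: "\<alpha> * int (\<mu> i) + \<beta> * int q = 1"
    using bezout_int[of "int (\<mu> i)" "int q"] by (auto simp: mult.commute)
  define y where "y = (\<Sum>l\<in>I - {i}. real (\<mu> l div q) *\<^sub>R v l)"
  have y: "y \<in> int_lattice"
    unfolding y_def using lat by (intro int_lattice_sum int_lattice_scaleR) auto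
  have "real (\<mu> i) *\<^sub>R v i + (\<Sum>l\<in>I - {i}. real (\<mu> l) *\<^sub>R v l) = 0"
    using rel I by (simp add: sum.remove)
  moreover have "(\<Sum>l\<in>I - {i}. real (\<mu> l) *\<^sub>R v l) = real q *\<^sub>R y"
    unfolding y_def scaleR_sum_right scaleR_scaleR
  proof (rule sum.cong)
    fix l
    assume "l \<in> I - {i}"
    then have "\<mu> l = q * (\<mu> l div q)"
      using q_dvd by simp
    then show "real (\<mu> l) *\<^sub>R v l = (real q * real (\<mu> l div q)) *\<^sub>R v l"
      by (metis of_nat_mult)
  qed simp
  ultimately have rel_i: "real (\<mu> i) *\<^sub>R v i = - (real q *\<^sub>R y)"
    by (simp add: eq_neg_iff_add_eq_0)
  have "1 = real_of_int \<alpha> * real (\<mu> i) + real_of_int \<beta> * real q"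
    using arg_cong[OF bezout, of real_of_int] by simp
  then have "v i = (real_of_int \<alpha> * real (\<mu> i) + real_of_int \<beta> * real q) *\<^sub>R v i"
    by simp
  also have "\<dots> = real_of_int \<alpha> *\<^sub>R (real (\<mu> i) *\<^sub>R v i) + (real_of_int \<beta> * real q) *\<^sub>R v i"
    by (simp add: scaleR_add_left)
  also have "\<dots> = real q *\<^sub>R (real_of_int \<beta> *\<^sub>R v i - real_of_int \<alpha> *\<^sub>R y)"
    unfolding rel_i by (simp add: scaleR_diff_right mult.commute)
  finally have "q = 1"
    using prim y unfolding primitive_def
    by (metis Ints_of_int int_lattice_diff int_lattice_scaleR)
  then show ?thesis
    by (simp add: q_def)
qed

context
  fixes v :: "nat \<Rightarrow> real^'n"
  assumes pos: "\<And>l. l \<le> CARD('n) \<Longrightarrow> facet_index v l > 0"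
begin

lemma simplex_mult_pos: "simplex_mult v > 0"
proof -
  have "simplex_mult v dvd facet_index v 0"
    unfolding simplex_mult_def by (rule Gcd_dvd) simp
  then show ?thesis
    using pos[of 0] by (simp add: dvd_pos_nat)
qed

lemma facet_index_eq_mult_weight: "l \<le> CARD('n) \<Longrightarrow> facet_index v l = simplex_mult v * weight v l"
  unfolding weight_def simplex_mult_def by (simp add: Gcd_dvd)

lemma weight_pos: "l \<le> CARD('n) \<Longrightarrow> weight v l > 0"
  using pos[of l] facet_index_eq_mult_weight[of l] by (metis mult_0_right neq0_conv)

lemma Gcd_weight: "Gcd (weight v ` {..CARD('n)}) = 1"
proof -
  have "facet_index v ` {..CARD('n)} = (*) (simplex_mult v) ` weight v ` {..CARD('n)}"
    unfolding image_image by (rule image_cong) (auto simp: facet_index_eq_mult_weight)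
  then have "simplex_mult v = simplex_mult v * Gcd (weight v ` {..CARD('n)})"
    unfolding simplex_mult_def by (metis Gcd_mult normalize_nat_def id_apply)
  then show ?thesis
    using simplex_mult_pos by simp
qed

end

text \<open>
  There are two families of vectors because a mutation is determined only up to a unimodular map: \<open>v\<close>
  will list the vertices of the chosen representative and \<open>x\<close> those of the mutation itself, whose
  vertex \<open>x i\<close> is also a vertex of the original simplex and hence primitive.
\<close>
lemma Gcd_weight_facet:
  fixes v x :: "nat \<Rightarrow> real^'n"
  assumes pos: "\<And>l. l \<le> CARD('n) \<Longrightarrow> facet_index v l > 0" and i: "i \<le> CARD('n)"
    and rel: "(\<Sum>l\<le>CARD('n). real (facet_index v l) *\<^sub>R x l) = 0"
    and lat: "\<And>l. l \<le> CARD('n) \<Longrightarrow> x l \<in> int_lattice" and prim: "primitive (x i)"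
  shows "Gcd (weight v ` ({..CARD('n)} - {i})) = 1"
proof (rule Gcd_omit_primitive)
  have "(\<Sum>l\<le>CARD('n). real (facet_index v l) *\<^sub>R x l)
      = real (simplex_mult v) *\<^sub>R (\<Sum>l\<le>CARD('n). real (weight v l) *\<^sub>R x l)"
    unfolding scaleR_sum_right by (rule sum.cong) (simp_all add: facet_index_eq_mult_weight[OF pos])
  then show "(\<Sum>l\<le>CARD('n). real (weight v l) *\<^sub>R x l) = 0"
    using rel simplex_mult_pos[of v] pos by simp
qed (use i lat prim Gcd_weight[of v] pos in auto)

text \<open>
  The factor of proportionality is the quotient of the two greatest common divisors.
\<close>
lemma Gcd_1_proportional_eq:
  fixes f g :: "'a \<Rightarrow> nat"
  assumes "Gcd (f ` A) = 1" "Gcd (g ` A) = 1"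
    and cross: "\<And>a b. a \<in> A \<Longrightarrow> b \<in> A \<Longrightarrow> f a * g b = g a * f b" and a: "a \<in> A"
  shows "f a = g a"
proof -
  have "f a * Gcd (g ` A) = Gcd ((*) (f a) ` g ` A)"
    by (simp add: Gcd_mult)
  also have "(*) (f a) ` g ` A = (*) (g a) ` f ` A"
    unfolding image_image by (rule image_cong) (auto simp: cross a)
  also have "Gcd ((*) (g a) ` f ` A) = g a * Gcd (f ` A)"
    by (simp add: Gcd_mult)
  finally show ?thesis
    using assms(1,2) by simp
qed

lemma square_part_square_mult:
  fixes x y :: nat
  shows "square_part (x\<^sup>2 * y) = x * square_part y"
proof (cases "x = 0 \<or> y = 0")
  case False
  show ?thesis
  proof (rule multiplicity_eq_nat)
    fix p :: nat
    assume "prime p"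
    then have "prime_elem p"
      by simp
    then show "multiplicity p (square_part (x\<^sup>2 * y)) = multiplicity p (x * square_part y)"
      using False \<open>prime p\<close>
      by (simp add: prime_multiplicity_square_part prime_elem_multiplicity_mult_distrib
          prime_elem_multiplicity_power_distrib)
  qed (use False in \<open>auto intro!: Nat.gr0I\<close>)
qed auto

section \<open>The relation between the vertices of a Fano simplex\<close>

locale labelled_fano_simplex =
  fixes P :: "(real^'n) set" and v :: "nat \<Rightarrow> real^'n"
  assumes fano: "fano_simplex P" and labelling: "vertex_labelling P v"
begin

lemma
  shows hull: "P = convex hull (v ` {..CARD('n)})"
    and aff_indep: "\<not> affine_dependent (v ` {..CARD('n)})"
    and inj_v: "inj_on v {..CARD('n)}"
    and primitive_vertex: "l \<le> CARD('n) \<Longrightarrow> primitive (v l)"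
proof -
  obtain C where C: "\<not> affine_dependent C" "P = convex hull C"
    using fano unfolding fano_simplex_def simplex_def by blast
  have bij: "bij_betw v {..CARD('n)} {x. x extreme_point_of P}"
    using labelling unfolding vertex_labelling_def .
  have "{x. x extreme_point_of P} = C"
    unfolding C(2) using extreme_point_of_convex_hull_affine_independent[OF C(1)] by blast
  then have "v ` {..CARD('n)} = C"
    using bij by (simp add: bij_betw_def)
  then show "P = convex hull (v ` {..CARD('n)})" "\<not> affine_dependent (v ` {..CARD('n)})"
    using C by auto
  show "inj_on v {..CARD('n)}"
    using bij by (simp add: bij_betw_def)
  show "primitive (v l)" if "l \<le> CARD('n)"
    using fano that bij_betw_imp_surj_on[OF bij] unfolding fano_simplex_def by blast
qed

lemma vertex_in_lattice: "l \<le> CARD('n) \<Longrightarrow> v l \<in> int_lattice"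
  using primitive_vertex primitive_def by blast

lemma vertex_in_P: "l \<le> CARD('n) \<Longrightarrow> v l \<in> P"
  unfolding hull by (rule hull_inc) simp

lemma positive_relation:
  obtains b where "\<And>l. l \<le> CARD('n) \<Longrightarrow> b l > 0" "(\<Sum>l\<le>CARD('n). b l *\<^sub>R v l) = 0"
proof -
  have "0 \<in> interior (convex hull (v ` {..CARD('n)}))"
    using fano hull unfolding fano_simplex_def by simp
  moreover have "card (v ` {..CARD('n)}) = Suc (CARD('n))"
    by (simp add: card_image[OF inj_v])
  ultimately obtain u where u: "\<And>x. x \<in> v ` {..CARD('n)} \<Longrightarrow> 0 < u x"
      "(\<Sum>x\<in>v ` {..CARD('n)}. u x *\<^sub>R x) = 0"
    unfolding interior_convex_hull_explicit_minimal[OF aff_indep] by auto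
  show ?thesis
    using that[of "u \<circ> v"] u by (simp add: sum.reindex[OF inj_v])
qed

lemma relation_normal_form:
  assumes i: "i \<le> CARD('n)" and e: "bij_betw e UNIV ({..CARD('n)} - {i})"
    and b: "b i \<noteq> 0" "(\<Sum>l\<le>CARD('n). b l *\<^sub>R v l) = 0"
  shows "v i = facet_map v e (\<chi> a. - b (e a) / b i)"
proof -
  have "b i *\<^sub>R v i = - (\<Sum>l\<in>{..CARD('n)} - {i}. b l *\<^sub>R v l)"
    using b(2) i by (simp add: sum.remove[of "{..CARD('n)}" i] eq_neg_iff_add_eq_0)
  then have "v i = (1 / b i) *\<^sub>R - (\<Sum>l\<in>{..CARD('n)} - {i}. b l *\<^sub>R v l)"
    using b(1) by (metis divide_self_if scaleR_one scaleR_scaleR times_divide_eq_left mult_1)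
  also have "\<dots> = (\<Sum>l\<in>{..CARD('n)} - {i}. (- b l / b i) *\<^sub>R v l)"
    by (simp add: scaleR_sum_right sum_negf)
  also have "\<dots> = facet_map v e (\<chi> a. - b (e a) / b i)"
    by (rule facet_map_eq_sum[OF e, symmetric])
  finally show ?thesis .
qed

text \<open>
  The span of the vertices of a facet contains the opposite vertex as well, by the relation, hence all
  of \<open>P\<close>; as \<open>P\<close> has interior points, it is the whole space.
\<close>
lemma inj_facet_map:
  assumes i: "i \<le> CARD('n)" and e: "bij_betw e UNIV ({..CARD('n)} - {i})"
  shows "inj (facet_map v e)"
proof -
  obtain b where b: "\<And>l. l \<le> CARD('n) \<Longrightarrow> b l > 0" "(\<Sum>l\<le>CARD('n). b l *\<^sub>R v l) = 0"
    using positive_relation by blast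
  let ?V = "range (facet_map v e)"
  have V: "subspace ?V"
    using linear_facet_map by (rule linear_subspace_image[OF _ subspace_UNIV])
  have "v l \<in> ?V" if "l \<le> CARD('n)" for l
  proof (cases "l = i")
    case True
    then show ?thesis
      using relation_normal_form[OF i e _ b(2)] b(1)[OF i] by auto
  next
    case False
    then obtain a where "e a = l"
      using bij_betw_imp_surj_on[OF e] \<open>l \<le> CARD('n)\<close> by (metis DiffI atMost_iff imageE singletonD)
    then show ?thesis
      by (metis facet_map_axis rangeI)
  qed
  then have "P \<subseteq> ?V"
    unfolding hull using subspace_imp_convex[OF V] by (intro hull_minimal) auto
  then have "interior ?V \<noteq> {}"
    using fano interior_mono unfolding fano_simplex_def by blast
  then have "dim ?V = CARD('n)"
    using empty_interior_lowdim[of ?V] dim_subset_UNIV[of ?V] by fastforce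
  then have "?V = UNIV"
    using V by (metis DIM_cart DIM_real dim_eq_full mult.right_neutral span_eq_iff)
  then show ?thesis
    using linear_facet_map linear_surjective_imp_injective by blast
qed

lemma facet_index_pos:
  assumes "i \<le> CARD('n)"
  shows "facet_index v i > 0"
proof -
  obtain e :: "'n \<Rightarrow> nat" where e: "bij_betw e UNIV ({..CARD('n)} - {i})"
    using facet_enumeration[OF assms] .
  then have "det (matrix (facet_map v e)) \<noteq> 0"
    using inj_facet_map[OF assms e] det_nz_iff_inj[OF linear_facet_map] by blast
  then show ?thesis
    using facet_index_eq_det[OF e inj_facet_map[OF assms e]] vertex_in_lattice by (metis abs_eq_0 neq0_conv of_nat_0)
qed

text \<open>
  The facet indices are proportional to any positive relation between the vertices, because passing
  from the facet opposite \<open>v 0\<close> to the one opposite \<open>v j\<close> replaces \<open>v j\<close> by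
  \<open>v 0\<close> in the determinant, and \<open>v 0\<close> is the sum of the vectors \<open>(- b l / b 0) *\<^sub>R v l\<close> with \<open>l \<noteq> 0\<close>.
\<close>
lemma facet_index_relation: "(\<Sum>l\<le>CARD('n). real (facet_index v l) *\<^sub>R v l) = 0"
proof -
  obtain b where b: "\<And>l. l \<le> CARD('n) \<Longrightarrow> b l > 0" "(\<Sum>l\<le>CARD('n). b l *\<^sub>R v l) = 0"
    using positive_relation by blast
  obtain e :: "'n \<Rightarrow> nat" where e: "bij_betw e UNIV ({..CARD('n)} - {0})"
    using facet_enumeration[of 0] by auto
  have idx0: "real (facet_index v 0) = \<bar>det (matrix (facet_map v e))\<bar>"
    using e inj_facet_map vertex_in_lattice by (intro facet_index_eq_det) auto
  have v0: "v 0 = facet_map v e (\<chi> a. - b (e a) / b 0)"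
    using b(1)[of 0] by (intro relation_normal_form e b(2)) auto
  have proportional: "real (facet_index v j) = real (facet_index v 0) / b 0 * b j"
    if j: "j \<le> CARD('n)" for j
  proof (cases "j = 0")
    case True
    then show ?thesis
      using b(1)[of 0] by simp
  next
    case False
    then obtain a where a: "e a = j"
      using bij_betw_imp_surj_on[OF e] j by (metis DiffI atMost_iff imageE singletonD)
    have inj: "inj e" and ran: "range e = {..CARD('n)} - {0}"
      using e by (auto simp: bij_betw_def)
    have "e ` (UNIV - {a}) = {..CARD('n)} - {0} - {j}"
      using image_set_diff[OF inj, of UNIV "{a}"] ran a by simp
    then have "(e(a := 0)) ` UNIV = insert 0 ({..CARD('n)} - {0} - {j})"
      using fun_upd_image[of e a 0 UNIV] by simp
    also have "\<dots> = {..CARD('n)} - {j}"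
      using False by auto
    finally have "range (e(a := 0)) = {..CARD('n)} - {j}" .
    moreover have "inj (e(a := 0))"
      using ran by (intro inj_on_fun_updI inj) auto
    ultimately have e': "bij_betw (e(a := 0)) UNIV ({..CARD('n)} - {j})"
      unfolding bij_betw_def by simp
    have "real (facet_index v j) = \<bar>det (matrix (facet_map v (e(a := 0))))\<bar>"
      using e' inj_facet_map[OF j e'] vertex_in_lattice by (intro facet_index_eq_det) auto
    also have "\<dots> = b j / b 0 * real (facet_index v 0)"
      unfolding det_facet_map_swap[OF v0] using a b(1)[of 0] b(1)[OF j] by (simp add: idx0 abs_mult)
    finally show ?thesis
      by simp
  qed
  have "(\<Sum>l\<le>CARD('n). real (facet_index v l) *\<^sub>R v l)
      = (real (facet_index v 0) / b 0) *\<^sub>R (\<Sum>l\<le>CARD('n). b l *\<^sub>R v l)"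
    unfolding scaleR_sum_right scaleR_scaleR
  proof (rule sum.cong)
    fix l
    assume "l \<in> {..CARD('n)}"
    then show "real (facet_index v l) *\<^sub>R v l = (real (facet_index v 0) / b 0 * b l) *\<^sub>R v l"
      using proportional[of l] by simp
  qed simp
  then show ?thesis
    using b(2) by simp
qed

end

section \<open>The volume of the polar dual\<close>

lemma std_simplex_cart:
  "convex hull (insert 0 Basis) = {z::real^'n. (\<forall>a. 0 \<le> z $ a) \<and> (\<Sum>a\<in>UNIV. z $ a) \<le> 1}"
proof -
  have Basis: "Basis = (\<lambda>a. axis a 1 :: real^'n) ` UNIV"
    by (auto simp: Basis_vec_def)
  have "inj (\<lambda>a. axis a 1 :: real^'n)"
    by (simp add: inj_def axis_eq_axis)
  then have "(\<Sum>b\<in>Basis. z \<bullet> b) = (\<Sum>a\<in>UNIV. z $ a)" for z :: "real^'n"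
    unfolding Basis by (simp add: sum.reindex inner_axis)
  then show ?thesis
    unfolding std_simplex by (simp add: Basis inner_axis)
qed

context labelled_fano_simplex
begin

lemma polar_dual_eq: "polar_dual P = {u. \<forall>l\<le>CARD('n). - 1 \<le> u \<bullet> v l}"
proof (intro equalityI subsetI)
  fix u
  assume "u \<in> {u. \<forall>l\<le>CARD('n). - 1 \<le> u \<bullet> v l}"
  then have "P \<subseteq> {x. - 1 \<le> u \<bullet> x}"
    unfolding hull using convex_halfspace_ge[where a=u and b="-1"] by (intro hull_minimal) auto
  then show "u \<in> polar_dual P"
    by (auto simp: polar_dual_def)
qed (use vertex_in_P in \<open>auto simp: polar_dual_def\<close>)

text \<open>
  The map \<open>u \<mapsto> g u + c\<close> of the proof has the coordinates \<open>\<kappa> l * (u \<bullet> v l + 1) / \<Lambda>\<close>, \<open>l \<noteq> 0\<close>, where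
  \<open>\<kappa> l\<close> is the facet index and \<open>\<Lambda>\<close> the sum of all of them. By the relation between the vertices
  they add up to \<open>1 - \<kappa> 0 * (u \<bullet> v 0 + 1) / \<Lambda>\<close>. So the inequality given by \<open>v 0\<close> is the one that
  bounds the sum of the coordinates by \<open>1\<close>, the others are the positivity of the coordinates, and the
  image of the polar dual is the standard simplex.
\<close>
lemma measure_polar_dual:
  "measure lebesgue (polar_dual P) = (\<Sum>l\<le>CARD('n). real (facet_index v l)) ^ CARD('n)
     / (fact CARD('n) * (\<Prod>l\<le>CARD('n). real (facet_index v l)))"
proof -
  define \<kappa> where "\<kappa> l = real (facet_index v l)" for l
  define \<Lambda> where "\<Lambda> = (\<Sum>l\<le>CARD('n). \<kappa> l)"
  have pos: "\<kappa> l > 0" if "l \<le> CARD('n)" for l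
    using facet_index_pos[OF that] by (simp add: \<kappa>_def)
  then have \<Lambda>: "\<Lambda> > 0"
    unfolding \<Lambda>_def by (intro sum_pos) auto
  obtain e :: "'n \<Rightarrow> nat" where e: "bij_betw e UNIV ({..CARD('n)} - {0})"
    using facet_enumeration[of 0] by auto
  have inj_e: "inj (facet_map v e)"
    using e by (intro inj_facet_map[of 0]) auto
  have e_in: "e a \<le> CARD('n)" for a
    using bij_betw_imp_surj_on[OF e] by auto
  have all_e: "(\<forall>l\<le>CARD('n). Q l) \<longleftrightarrow> Q 0 \<and> (\<forall>a. Q (e a))" for Q
    using bij_betw_imp_surj_on[OF e] by (metis DiffI atMost_iff e_in imageE le0 singletonD)
  have sum_e: "(\<Sum>l\<le>CARD('n). g l) = g 0 + (\<Sum>a\<in>UNIV. g (e a))" for g :: "nat \<Rightarrow> real"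
    using sum.reindex_bij_betw[OF e, of g] by (simp add: sum.remove[of _ 0])
  have prod_e: "(\<Prod>l\<le>CARD('n). g l) = g 0 * (\<Prod>a\<in>UNIV. g (e a))" for g :: "nat \<Rightarrow> real"
    using prod.reindex_bij_betw[OF e, of g] by (simp add: prod.remove[of _ 0])
  define g :: "real^'n \<Rightarrow> real^'n" where "g u = (\<chi> a. \<kappa> (e a) / \<Lambda> * (v (e a) \<bullet> u))" for u
  define c :: "real^'n" where "c = (\<chi> a. \<kappa> (e a) / \<Lambda>)"
  define std :: "(real^'n) set" where "std = convex hull (insert 0 Basis)"
  have g: "linear g"
    by (rule linearI) (auto simp: g_def vec_eq_iff inner_add_right algebra_simps add_divide_distrib)
  have "matrix g = (\<chi> a. (\<kappa> (e a) / \<Lambda>) *s v (e a))"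
    by (simp add: matrix_def g_def vec_eq_iff inner_axis)
  then have "det (matrix g) = (\<Prod>a\<in>UNIV. \<kappa> (e a) / \<Lambda>) * det (\<chi> a. v (e a))"
    by (simp add: det_rows_mul)
  also have "(\<chi> a. v (e a)) = transpose (matrix (facet_map v e))"
    by (simp add: transpose_def vec_eq_iff matrix_facet_map)
  also have "(\<Prod>a\<in>UNIV. \<kappa> (e a) / \<Lambda>) = (\<Prod>a\<in>UNIV. \<kappa> (e a)) / \<Lambda> ^ CARD('n)"
    by (simp add: prod_dividef)
  finally have "\<bar>det (matrix g)\<bar>
      = (\<Prod>a\<in>UNIV. \<kappa> (e a)) / \<Lambda> ^ CARD('n) * \<bar>det (matrix (facet_map v e))\<bar>"
    using \<Lambda> pos e_in by (simp add: det_transpose abs_mult abs_prod less_imp_le)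
  also have "\<bar>det (matrix (facet_map v e))\<bar> = \<kappa> 0"
    unfolding \<kappa>_def using vertex_in_lattice
    by (intro facet_index_eq_det[symmetric] e inj_e) auto
  finally have det_g: "\<bar>det (matrix g)\<bar> = (\<Prod>l\<le>CARD('n). \<kappa> l) / \<Lambda> ^ CARD('n)"
    by (simp add: prod_e mult.commute)
  have prod_pos: "(\<Prod>l\<le>CARD('n). \<kappa> l) > 0"
    using pos by (intro prod_pos) auto
  then have "\<bar>det (matrix g)\<bar> > 0"
    unfolding det_g using \<Lambda> by (intro divide_pos_pos zero_less_power)
  then have inj_g: "inj g"
    using det_nz_iff_inj[OF g] by auto
  have surj_g: "surj g"
    using g inj_g linear_injective_imp_surjective by blast

  have mem: "u \<in> polar_dual P \<longleftrightarrow> g u + c \<in> std" for u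
  proof -
    have coord: "(g u + c) $ a = \<kappa> (e a) * (v (e a) \<bullet> u + 1) / \<Lambda>" for a
      by (simp add: g_def c_def algebra_simps add_divide_distrib)
    have nonneg: "0 \<le> (g u + c) $ a \<longleftrightarrow> - 1 \<le> u \<bullet> v (e a)" for a
      unfolding coord using \<Lambda> pos[OF e_in[of a]]
      by (simp add: zero_le_divide_iff zero_le_mult_iff inner_commute not_less) linarith
    have "(\<Sum>l\<le>CARD('n). \<kappa> l * (v l \<bullet> u)) = (\<Sum>l\<le>CARD('n). \<kappa> l *\<^sub>R v l) \<bullet> u"
      by (simp add: inner_sum_left)
    also have "\<dots> = 0"
      using facet_index_relation by (simp add: \<kappa>_def)
    finally have "\<kappa> 0 * (v 0 \<bullet> u) + (\<Sum>a\<in>UNIV. \<kappa> (e a) * (v (e a) \<bullet> u)) = 0"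
      by (simp add: sum_e)
    moreover have "\<Lambda> = \<kappa> 0 + (\<Sum>a\<in>UNIV. \<kappa> (e a))"
      by (simp add: \<Lambda>_def sum_e)
    ultimately have "(\<Sum>a\<in>UNIV. \<kappa> (e a) * (v (e a) \<bullet> u + 1)) = \<Lambda> - \<kappa> 0 * (v 0 \<bullet> u + 1)"
      by (simp add: algebra_simps sum.distrib)
    then have sum_coord: "(\<Sum>a\<in>UNIV. (g u + c) $ a) = (\<Lambda> - \<kappa> 0 * (v 0 \<bullet> u + 1)) / \<Lambda>"
      unfolding coord sum_divide_distrib[symmetric] by simp
    have "(\<Sum>a\<in>UNIV. (g u + c) $ a) \<le> 1 \<longleftrightarrow> 0 \<le> \<kappa> 0 * (v 0 \<bullet> u + 1)"
      unfolding sum_coord using \<Lambda> by (simp add: divide_le_eq_1)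
    also have "\<dots> \<longleftrightarrow> - 1 \<le> u \<bullet> v 0"
      using pos[of 0] by (simp add: zero_le_mult_iff inner_commute not_less) linarith
    finally show ?thesis
      unfolding std_def std_simplex_cart polar_dual_eq mem_Collect_eq all_e nonneg by blast
  qed
  have image: "g ` polar_dual P = (\<lambda>z. z - c) ` std"
  proof (intro equalityI subsetI)
    fix y
    assume "y \<in> g ` polar_dual P"
    then obtain u where "u \<in> polar_dual P" "y = g u"
      by blast
    then show "y \<in> (\<lambda>z. z - c) ` std"
      using mem[of u] by (intro image_eqI[of _ _ "g u + c"]) auto
  next
    fix y
    assume "y \<in> (\<lambda>z. z - c) ` std"
    moreover obtain u where "y = g u"
      using surj_g by (metis surjD)
    ultimately show "y \<in> g ` polar_dual P"
      using mem[of u] by auto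
  qed
  have std: "std \<in> lmeasurable"
    unfolding std_def by (intro lmeasurable_compact finite_imp_compact_convex_hull) auto
  obtain g' where g': "linear g'" "\<And>u. g' (g u) = u"
    using linear_injective_left_inverse[OF g inj_g] by (metis comp_apply id_apply)
  have "polar_dual P = g' ` (\<lambda>z. z - c) ` std"
    unfolding image[symmetric] by (simp add: image_image g')
  then have "polar_dual P \<in> lmeasurable"
    using linear_image_lebesgue[OF g'(1)] measurable_translation_subtract[OF std] by simp
  then have "measure lebesgue (g ` polar_dual P) = \<bar>det (matrix g)\<bar> * measure lebesgue (polar_dual P)"
    using linear_image_lebesgue[OF g] by blast
  moreover have "measure lebesgue (g ` polar_dual P) = 1 / fact CARD('n)"
    unfolding image measure_translation_subtract
    using content_std_simplex[where 'a="real^'n"] std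
    by (simp add: std_def compact_imp_closed finite_imp_compact_convex_hull borel_closed)
  ultimately have eq: "(\<Prod>l\<le>CARD('n). \<kappa> l) / \<Lambda> ^ CARD('n) * measure lebesgue (polar_dual P) = 1 / fact CARD('n)"
    unfolding det_g by simp
  have "m = L / (f * K)" if "K / L * m = 1 / f" "K > 0" "L > 0" "f > 0" for m L f K :: real
    using that by (simp add: field_simps)
  from this[OF eq prod_pos zero_less_power[OF \<Lambda>] fact_gt_zero]
  have "measure lebesgue (polar_dual P) = \<Lambda> ^ CARD('n) / (fact CARD('n) * (\<Prod>l\<le>CARD('n). \<kappa> l))" .
  then show ?thesis
    by (simp add: \<Lambda>_def \<kappa>_def)
qed

lemma measure_polar_dual_markov:
  "measure lebesgue (polar_dual P) =
     markov_m v ^ CARD('n) / (fact CARD('n) * (\<Prod>i\<le>CARD('n). real (markov_c v i))) *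
     ((\<Prod>i\<le>CARD('n). real (markov_a v i)) powi (int CARD('n) - 2) / real (simplex_mult v))"
proof -
  let ?n = "CARD('n)"
  define g where "g = real (simplex_mult v)"
  define S where "S = (\<Sum>l\<le>?n. real (weight v l))"
  define A where "A = (\<Prod>l\<le>?n. real (markov_a v l))"
  define B where "B = (\<Prod>l\<le>?n. real (markov_c v l))"
  have g: "g > 0"
    unfolding g_def using simplex_mult_pos[OF facet_index_pos] by simp
  have w: "weight v l > 0" if "l \<le> ?n" for l
    using weight_pos[OF facet_index_pos that] .
  have ca: "real (weight v l) = real (markov_c v l) * (real (markov_a v l))\<^sup>2" for l
    using weight_decomposition[of v l] by (metis of_nat_mult of_nat_power)
  have "real (markov_a v l) > 0" "real (markov_c v l) > 0" if "l \<le> ?n" for l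
    using w[OF that] weight_decomposition[of v l] by (auto intro!: Nat.gr0I)
  then have AB: "A > 0" "B > 0"
    unfolding A_def B_def by (auto intro!: prod_pos)
  have idx: "real (facet_index v l) = g * real (weight v l)" if "l \<le> ?n" for l
    unfolding g_def using facet_index_eq_mult_weight[OF facet_index_pos that] by simp
  have "(\<Sum>l\<le>?n. real (facet_index v l)) = g * S"
    unfolding S_def sum_distrib_left by (rule sum.cong) (simp_all add: idx)
  moreover have "(\<Prod>l\<le>?n. real (facet_index v l)) = (\<Prod>l\<le>?n. g * real (weight v l))"
    by (rule prod.cong) (simp_all add: idx)
  then have "(\<Prod>l\<le>?n. real (facet_index v l)) = g ^ Suc ?n * (B * A\<^sup>2)"
    by (simp add: ca prod.distrib prod_power_distrib A_def B_def)
  ultimately have "measure lebesgue (polar_dual P) = (g * S) ^ ?n / (fact ?n * (g ^ Suc ?n * (B * A\<^sup>2)))"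
    using measure_polar_dual by simp
  also have "\<dots> = S ^ ?n / (fact ?n * B) * (1 / (A\<^sup>2 * g))"
    using g AB by (simp add: power_mult_distrib field_simps)
  also have "S = markov_m v * A"
    unfolding markov_m_def S_def ca A_def[symmetric] using AB(1) by simp
  also have "(markov_m v * A) ^ ?n / (fact ?n * B) * (1 / (A\<^sup>2 * g))
      = markov_m v ^ ?n / (fact ?n * B) * (A ^ ?n / A\<^sup>2 / g)"
    by (simp add: power_mult_distrib field_simps)
  also have "A ^ ?n / A\<^sup>2 = A powi (int ?n - 2)"
    using AB(1) by (simp add: power_int_diff)
  finally show ?thesis
    by (simp add: A_def B_def g_def)
qed

end

section \<open>Independence of the labelling\<close>

lemma facet_index_relabel:
  fixes w z :: "nat \<Rightarrow> real^'n"
  assumes \<sigma>: "bij_betw \<sigma> {..CARD('n)} {..CARD('n)}"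
    and w: "\<And>l. l \<le> CARD('n) \<Longrightarrow> w l = z (\<sigma> l)" and l: "l \<le> CARD('n)"
  shows "facet_index w l = facet_index z (\<sigma> l)"
proof -
  have "\<sigma> ` ({..CARD('n)} - {l}) = {..CARD('n)} - {\<sigma> l}"
    using \<sigma> l inj_on_image_set_diff[of \<sigma> "{..CARD('n)}" "{..CARD('n)}" "{l}"]
    by (auto simp: bij_betw_def)
  moreover have "w ` ({..CARD('n)} - {l}) = z ` \<sigma> ` ({..CARD('n)} - {l})"
    unfolding image_image by (rule image_cong) (auto simp: w)
  ultimately show ?thesis
    by (simp add: facet_index_def)
qed

lemma
  fixes w z :: "nat \<Rightarrow> real^'n"
  assumes \<sigma>: "bij_betw \<sigma> {..CARD('n)} {..CARD('n)}"
    and w: "\<And>l. l \<le> CARD('n) \<Longrightarrow> w l = z (\<sigma> l)"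
  shows simplex_mult_relabel: "simplex_mult w = simplex_mult z"
    and prod_markov_a_relabel:
      "(\<Prod>l\<le>CARD('n). real (markov_a w l)) = (\<Prod>l\<le>CARD('n). real (markov_a z l))"
proof -
  have idx: "facet_index w l = facet_index z (\<sigma> l)" if "l \<le> CARD('n)" for l
    using \<sigma> w that by (rule facet_index_relabel)
  have "facet_index w ` {..CARD('n)} = facet_index z ` \<sigma> ` {..CARD('n)}"
    unfolding image_image by (rule image_cong) (auto simp: idx)
  then show mult: "simplex_mult w = simplex_mult z"
    using bij_betw_imp_surj_on[OF \<sigma>] by (simp add: simplex_mult_def)
  have "(\<Prod>l\<le>CARD('n). real (markov_a w l)) = (\<Prod>l\<le>CARD('n). real (markov_a z (\<sigma> l)))"
    by (rule prod.cong) (auto simp: markov_a_def weight_def mult idx)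
  also have "\<dots> = (\<Prod>l\<le>CARD('n). real (markov_a z l))"
    by (rule prod.reindex_bij_betw[OF \<sigma>])
  finally show "(\<Prod>l\<le>CARD('n). real (markov_a w l)) = (\<Prod>l\<le>CARD('n). real (markov_a z l))" .
qed

text \<open>
  That \<open>w\<close> exists means that \<open>Q\<close> has \<open>n + 1\<close> extreme points; as they are all among the \<open>z l\<close>, the \<open>z l\<close>
  are distinct and all of them are extreme.
\<close>
lemma labelling_of_convex_hull:
  fixes w z :: "nat \<Rightarrow> real^'n"
  assumes Q: "Q = convex hull (z ` {..CARD('n)})" and w: "vertex_labelling Q w"
  obtains \<sigma> where "bij_betw \<sigma> {..CARD('n)} {..CARD('n)}"
    and "\<And>l. l \<le> CARD('n) \<Longrightarrow> w l = z (\<sigma> l)"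
proof -
  let ?E = "{x. x extreme_point_of Q}"
  have bij: "bij_betw w {..CARD('n)} ?E"
    using w by (simp add: vertex_labelling_def)
  have sub: "?E \<subseteq> z ` {..CARD('n)}"
    unfolding Q by (rule extreme_points_of_convex_hull)
  have card: "card ?E = Suc (CARD('n))"
    using bij_betw_same_card[OF bij] by simp
  have "card (z ` {..CARD('n)}) \<le> Suc (CARD('n))"
    using card_image_le[of "{..CARD('n)}" z] by simp
  then have E: "?E = z ` {..CARD('n)}"
    using card by (intro card_seteq sub) auto
  then have "inj_on z {..CARD('n)}"
    using card by (intro eq_card_imp_inj_on) auto
  then have z: "bij_betw z {..CARD('n)} ?E"
    by (simp add: bij_betw_def E)
  show ?thesis
  proof (rule that[of "inv_into {..CARD('n)} z \<circ> w"])
    show "bij_betw (inv_into {..CARD('n)} z \<circ> w) {..CARD('n)} {..CARD('n)}"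
      by (rule bij_betw_trans[OF bij bij_betw_inv_into[OF z]])
    show "w l = z ((inv_into {..CARD('n)} z \<circ> w) l)" if "l \<le> CARD('n)" for l
      using that bij_betw_imp_surj_on[OF bij] E by (simp add: f_inv_into_f)
       (metis (mono_tags, lifting) atMost_iff f_inv_into_f imageI)
  qed
qed

section \<open>The vertices of a mutation\<close>

text \<open>
  A point of \<open>P\<close> at height \<open>h'\<close> is \<open>s *\<^sub>R p + t *\<^sub>R f\<close> with \<open>f \<in> F\<close>, \<open>s + t = 1\<close> and
  \<open>s * h - t * d = h'\<close>. Adding \<open>h' / d\<close> times a vector \<open>f2 - u\<close> gives a point on the segment from \<open>u\<close>
  to \<open>p + (h / d) *\<^sub>R (f3 - u)\<close>, where \<open>f3 \<in> F\<close> is the mean of \<open>f\<close> and \<open>f2\<close> with the weights \<open>t\<close> and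
  \<open>h' / d\<close>. So the slice of maximal height and \<open>u\<close> already span the mutation.
\<close>
lemma mutation_hull:
  fixes F P :: "(real^'n) set"
  assumes F: "convex F" "u \<in> F" "\<And>x. x \<in> F \<Longrightarrow> nF \<bullet> x = real d" and d: "d > 0"
    and p: "nF \<bullet> p = - real h" "p \<in> int_lattice" and h: "h > 0"
    and P: "P = convex hull (insert p F)"
  shows "mutation P F nF d u
    = convex hull (insert u ((\<lambda>x. p + (real h / real d) *\<^sub>R (x - u)) ` F))"
proof -
  define k where "k = real h / real d"
  have k: "k > 0" and kd: "k * real d = real h"
    using d h by (auto simp: k_def)
  have P_eq: "P = {x. \<exists>s\<ge>0. \<exists>t\<ge>0. \<exists>f. f \<in> F \<and> s + t = 1 \<and> x = s *\<^sub>R p + t *\<^sub>R f}"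
    unfolding P using F(2) by (subst convex_hull_insert) (auto simp: hull_same F(1))
  have "p \<in> P"
    unfolding P by (rule hull_inc) simp
  have height: "- nF \<bullet> (s *\<^sub>R p + t *\<^sub>R f) = s * real h - t * real d" if "f \<in> F" for s t f
    using F(3)[OF that] p(1) by (simp add: inner_add_right)
  have "max_height P (- nF) = real h"
    unfolding max_height_def
  proof (rule cSup_eq_maximum)
    show "real h \<in> (\<lambda>x. - nF \<bullet> x) ` P"
      using \<open>p \<in> P\<close> p(1) by (intro image_eqI[of _ _ p]) auto
  next
    fix y
    assume "y \<in> (\<lambda>x. - nF \<bullet> x) ` P"
    then obtain s t f where st: "s \<ge> 0" "t \<ge> 0" "s + t = 1" and "f \<in> F" and y: "y = s * real h - t * real d"
      unfolding P_eq using height by auto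
    have "s * real h \<le> 1 * real h" "0 \<le> t * real d"
      using st mult_right_mono[of s 1 "real h"] by auto
    then show "y \<le> real h"
      unfolding y by linarith
  qed
  then have heights: "{h'. real h' \<le> max_height P (- nF)} = {..h}"
    by auto
  let ?S = "\<lambda>h'. {x + real h' *\<^sub>R g |x g. x \<in> lattice_slice P (- nF) h' \<and> g \<in> mutation_factor F d u}"
  let ?H = "convex hull (insert u ((\<lambda>x. p + k *\<^sub>R (x - u)) ` F))"
  have slice: "?S h' \<subseteq> ?H" for h'
  proof
    fix y
    assume "y \<in> ?S h'"
    then obtain x f2 where x: "x \<in> lattice_slice P (- nF) h'" and f2: "f2 \<in> F"
      and y: "y = x + real h' *\<^sub>R ((1 / real d) *\<^sub>R (f2 - u))"
      unfolding mutation_factor_def by blast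
    have "convex (P \<inter> {x. - nF \<bullet> x = real h'})"
      unfolding P by (intro convex_Int convex_convex_hull convex_hyperplane)
    then have "lattice_slice P (- nF) h' \<subseteq> P \<inter> {x. - nF \<bullet> x = real h'}"
      unfolding lattice_slice_def by (intro hull_minimal) auto
    then have "x \<in> P" and x_height: "- nF \<bullet> x = real h'"
      using x by auto
    then obtain s t f where st: "s \<ge> 0" "t \<ge> 0" "s + t = 1" and f: "f \<in> F"
      and x_eq: "x = s *\<^sub>R p + t *\<^sub>R f"
      unfolding P_eq by blast
    have ht: "s * real h - t * real d = real h'"
      using x_height unfolding x_eq height[OF f] .
    have t_eq: "t = 1 - s"
      using st(3) by simp
    have "s * (real h + real d) = real h' + real d"
      using ht unfolding t_eq by (simp add: algebra_simps)
    then have "s > 0"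
      using d st(1) by (cases "s = 0") auto
    define m where "m = k * s"
    have m: "m > 0"
      using k \<open>s > 0\<close> by (simp add: m_def)
    \<comment> \<open>The condition on the height says exactly that the two weights add up to \<open>k * s\<close>.\<close>
    have m_eq: "t + real h' / real d = m"
      using ht d by (simp add: m_def k_def field_simps)
    define f3 where "f3 = (t / m) *\<^sub>R f + (real h' / real d / m) *\<^sub>R f2"
    have "t / m + real h' / real d / m = 1"
      using m m_eq by (metis add_divide_distrib divide_self_if less_numeral_extra(3))
    then have "f3 \<in> F"
      unfolding f3_def using m st by (intro convexD[OF F(1) f f2]) auto
    have mf3: "m *\<^sub>R f3 = t *\<^sub>R f + (real h' / real d) *\<^sub>R f2"
      using m by (simp add: f3_def scaleR_add_right)
    have hd: "real h' / real d = m - t"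
      using m_eq by simp
    have "y = s *\<^sub>R p + t *\<^sub>R f + (real h' / real d) *\<^sub>R f2 - (real h' / real d) *\<^sub>R u"
      unfolding y x_eq by (simp add: scaleR_diff_right)
    also have "\<dots> = s *\<^sub>R p + m *\<^sub>R f3 - (m - t) *\<^sub>R u"
      unfolding mf3 hd by (simp add: add.assoc)
    also have "\<dots> = t *\<^sub>R u + s *\<^sub>R (p + k *\<^sub>R (f3 - u))"
      by (simp add: m_def algebra_simps)
    finally have y_eq: "y = t *\<^sub>R u + s *\<^sub>R (p + k *\<^sub>R (f3 - u))" .
    show "y \<in> ?H"
      unfolding y_eq using st \<open>f3 \<in> F\<close>
      by (intro convexD[OF convex_convex_hull] hull_inc) auto
  qed
  have top: "(\<lambda>x. p + k *\<^sub>R (x - u)) ` F \<subseteq> ?S h"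
  proof
    fix y
    assume "y \<in> (\<lambda>x. p + k *\<^sub>R (x - u)) ` F"
    then obtain x where x: "x \<in> F" "y = p + k *\<^sub>R (x - u)"
      by blast
    have "p \<in> lattice_slice P (- nF) h"
      unfolding lattice_slice_def using \<open>p \<in> P\<close> p by (intro hull_inc) auto
    moreover have "(1 / real d) *\<^sub>R (x - u) \<in> mutation_factor F d u"
      unfolding mutation_factor_def using x(1) by blast
    moreover have "y = p + real h *\<^sub>R ((1 / real d) *\<^sub>R (x - u))"
      using x(2) by (simp add: k_def)
    ultimately show "y \<in> ?S h"
      by blast
  qed
  have "convex hull ({u} \<union> (\<Union>h'\<in>{..h}. ?S h')) = ?H"
  proof (intro equalityI)
    have "u \<in> ?H"
      by (rule hull_inc) simp
    then show "convex hull ({u} \<union> (\<Union>h'\<in>{..h}. ?S h')) \<subseteq> ?H"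
      using slice by (intro hull_minimal convex_convex_hull) blast
    show "?H \<subseteq> convex hull ({u} \<union> (\<Union>h'\<in>{..h}. ?S h'))"
      using top by (intro hull_mono) blast
  qed
  then show ?thesis
    unfolding mutation_def heights k_def .
qed

text \<open>
  Dividing a face by \<open>d\<close> after a translation is an affine isomorphism, so it preserves extreme points.
  Applied to an admissible facet, it shows that the differences of its vertices are divisible by \<open>d\<close>.
\<close>
lemma extreme_point_of_mutation_factor:
  assumes "x extreme_point_of F" and "d > 0"
  shows "((1 / real d) *\<^sub>R (x - u)) extreme_point_of (mutation_factor F d u)"
proof -
  have "{x - u} face_of (+) (- u) ` F"
    using assms(1) face_of_translation_eq[of "- u" "{x}" F] by (simp add: face_of_singleton)
  then have "(*\<^sub>R) (1 / real d) ` {x - u} face_of (*\<^sub>R) (1 / real d) ` (+) (- u) ` F"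
    using assms(2) by (subst face_of_linear_image) (auto simp: inj_on_def linear_scaleR)
  moreover have "(*\<^sub>R) (1 / real d) ` (+) (- u) ` F = mutation_factor F d u"
    by (simp add: mutation_factor_def image_image)
  ultimately show ?thesis
    by (simp add: face_of_singleton)
qed

lemma admissible_vertex_differences:
  assumes adm: "admissible F d" and d: "d > 0"
    and xy: "x extreme_point_of F" "y extreme_point_of F"
  shows "(1 / real d) *\<^sub>R (x - y) \<in> int_lattice"
proof -
  obtain u S where S: "S \<subseteq> int_lattice" "mutation_factor F d u = convex hull S"
    using adm unfolding admissible_def lattice_polytope_def by blast
  have "(1 / real d) *\<^sub>R (y - u) \<in> int_lattice" if "y extreme_point_of F" for y
    using extreme_point_of_mutation_factor[OF that d, of u] S extreme_point_of_convex_hull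
    unfolding S(2) by blast
  from this[OF xy(1)] this[OF xy(2)]
  have "(1 / real d) *\<^sub>R (x - u) - (1 / real d) *\<^sub>R (y - u) \<in> int_lattice"
    by (rule int_lattice_diff)
  then show ?thesis
    by (simp add: algebra_simps)
qed

lemma inner_int_lattice: "x \<in> int_lattice \<Longrightarrow> y \<in> int_lattice \<Longrightarrow> x \<bullet> y \<in> \<int>"
  by (auto simp: inner_vec_def int_lattice_def intro!: Ints_sum)

text \<open>
  The linear map that extends the affine map \<open>x \<mapsto> p + k *\<^sub>R (x - u)\<close> from the hyperplane \<open>nF \<bullet> x = d\<close>
  to the whole space. If \<open>nF \<bullet> u = d\<close> and \<open>nF \<bullet> p = - (k * d)\<close>, then \<open>1 / k\<close> times this map is a
  reflection: it fixes the hyperplane \<open>nF \<bullet> x = 0\<close> and negates \<open>p - k *\<^sub>R u\<close>.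
\<close>
definition mutation_map :: "real^'n \<Rightarrow> real \<Rightarrow> real \<Rightarrow> real^'n \<Rightarrow> real^'n \<Rightarrow> real^'n \<Rightarrow> real^'n" where
  "mutation_map nF d k p u x = k *\<^sub>R x + ((nF \<bullet> x) / d) *\<^sub>R (p - k *\<^sub>R u)"

lemma linear_mutation_map: "linear (mutation_map nF d k p u)"
  by (rule linearI) (auto simp: mutation_map_def inner_add_right algebra_simps add_divide_distrib)

lemma mutation_map_facet:
  assumes "nF \<bullet> x = d" "d \<noteq> 0"
  shows "mutation_map nF d k p u x = p + k *\<^sub>R (x - u)"
  using assms by (simp add: mutation_map_def algebra_simps)

lemma mutation_map_apex:
  assumes "nF \<bullet> p = - (k * d)" "d \<noteq> 0"
  shows "mutation_map nF d k p u p = k\<^sup>2 *\<^sub>R u"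
  using assms by (simp add: mutation_map_def algebra_simps power2_eq_square)

lemma mutation_map_involutive:
  assumes "nF \<bullet> p = - (k * d)" "nF \<bullet> u = d" "d \<noteq> 0"
  shows "mutation_map nF d k p u (mutation_map nF d k p u x) = k\<^sup>2 *\<^sub>R x"
proof -
  define a where "a = p - k *\<^sub>R u"
  define \<phi> where "\<phi> = (nF \<bullet> x) / d"
  have T: "mutation_map nF d k p u y = k *\<^sub>R y + ((nF \<bullet> y) / d) *\<^sub>R a" for y
    by (simp add: mutation_map_def a_def)
  have "nF \<bullet> a = - 2 * k * d"
    using assms by (simp add: a_def inner_diff_right)
  moreover have "nF \<bullet> x = \<phi> * d"
    using assms(3) by (simp add: \<phi>_def)
  ultimately have "nF \<bullet> (k *\<^sub>R x + \<phi> *\<^sub>R a) / d = - k * \<phi>"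
    using assms(3) by (simp add: inner_add_right field_simps)
  then show ?thesis
    unfolding T \<phi>_def[symmetric] by (simp add: algebra_simps power2_eq_square)
qed

lemma abs_det_mutation_map:
  fixes nF p u :: "real^'n"
  assumes "nF \<bullet> p = - (k * d)" "nF \<bullet> u = d" "d \<noteq> 0" and k: "k > 0"
  shows "\<bar>det (matrix (mutation_map nF d k p u))\<bar> = k ^ CARD('n)"
proof -
  let ?T = "mutation_map nF d k p u"
  have "?T \<circ> ?T = (*\<^sub>R) (k\<^sup>2)"
    using mutation_map_involutive[OF assms(1-3)] by (simp add: fun_eq_iff)
  then have "det (matrix ?T) * det (matrix ?T) = (k\<^sup>2) ^ CARD('n)"
    using matrix_compose[OF linear_mutation_map linear_mutation_map, of nF d k p u nF d k p u]
    by (metis det_matrix_scaleR det_mul)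
  then have "\<bar>det (matrix ?T)\<bar>\<^sup>2 = (k ^ CARD('n))\<^sup>2"
    by (simp add: power2_eq_square power_mult_distrib)
  then show ?thesis
    using k by (metis abs_ge_zero less_imp_le power2_eq_imp_eq zero_le_power)
qed

context labelled_fano_simplex
begin

text \<open>
  The height of \<open>v i\<close> is a positive integer \<open>h\<close>: pair \<open>nF\<close> with the relation between the vertices, in
  which all other vertices contribute positively.
\<close>
lemma mutation_eq_hull:
  assumes F: "F facet_of P" and normal: "facet_normal P F nF d" and adm: "admissible F d"
    and u: "u extreme_point_of F"
  obtains i h where "i \<le> CARD('n)" "h > 0" "d > 0" "nF \<bullet> v i = - real h"
    and "\<And>l. l \<le> CARD('n) \<Longrightarrow> l \<noteq> i \<Longrightarrow> nF \<bullet> v l = real d"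
    and "u \<in> v ` ({..CARD('n)} - {i})"
    and "\<And>l. l \<le> CARD('n) \<Longrightarrow> l \<noteq> i \<Longrightarrow> (1 / real d) *\<^sub>R (v l - u) \<in> int_lattice"
    and "mutation P F nF d u = convex hull (insert u
      ((\<lambda>l. mutation_map nF (real d) (real h / real d) (v i) u (v l)) ` ({..CARD('n)} - {i})))"
proof -
  obtain y where y: "y \<in> v ` {..CARD('n)}" "F = convex hull (v ` {..CARD('n)} - {y})"
    using F facet_of_convex_hull_affine_independent[OF aff_indep] unfolding hull by blast
  obtain i where i: "i \<le> CARD('n)" "y = v i"
    using y(1) by auto
  define I where "I = {..CARD('n)} - {i}"
  have I: "finite I" "l \<in> I \<longleftrightarrow> l \<le> CARD('n) \<and> l \<noteq> i" for l
    by (auto simp: I_def)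
  have vI: "v ` {..CARD('n)} - {y} = v ` I"
    using inj_on_image_set_diff[OF inj_v, of "{..CARD('n)}" "{i}"] i by (auto simp: I_def)
  then have F_eq: "F = convex hull (v ` I)"
    using y(2) by simp
  have extreme_F: "x extreme_point_of F \<longleftrightarrow> x \<in> v ` I" for x
    unfolding F_eq
    by (rule extreme_point_of_convex_hull_affine_independent)
       (rule affine_independent_subset[OF aff_indep], auto simp: I_def)
  have prim: "primitive nF" and d: "d > 0" and nF_F: "\<And>x. x \<in> F \<Longrightarrow> nF \<bullet> x = real d"
    using normal unfolding facet_normal_def by auto
  have nF_I: "nF \<bullet> v l = real d" if "l \<in> I" for l
    using that by (intro nF_F) (simp add: F_eq hull_inc)
  have uI: "u \<in> v ` I"
    using u extreme_F by blast
  then have "I \<noteq> {}"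
    by auto

  have "0 = nF \<bullet> (\<Sum>l\<le>CARD('n). real (facet_index v l) *\<^sub>R v l)"
    using facet_index_relation by simp
  also have "\<dots> = (\<Sum>l\<le>CARD('n). real (facet_index v l) * (nF \<bullet> v l))"
    by (simp add: inner_sum_right)
  also have "\<dots> = real (facet_index v i) * (nF \<bullet> v i) + (\<Sum>l\<in>I. real (facet_index v l) * (nF \<bullet> v l))"
    unfolding I_def using i(1) by (subst sum.remove[of _ i]) auto
  also have "(\<Sum>l\<in>I. real (facet_index v l) * (nF \<bullet> v l)) = (\<Sum>l\<in>I. real (facet_index v l) * real d)"
    by (rule sum.cong) (simp_all add: nF_I)
  finally have "real (facet_index v i) * (nF \<bullet> v i) = - (\<Sum>l\<in>I. real (facet_index v l) * real d)"
    by simp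
  moreover have "(\<Sum>l\<in>I. real (facet_index v l) * real d) > 0"
    using I \<open>I \<noteq> {}\<close> d facet_index_pos by (intro sum_pos) auto
  ultimately have neg: "nF \<bullet> v i < 0"
    by (smt (verit) mult_nonneg_nonneg of_nat_0_le_iff)
  have "nF \<bullet> v i \<in> \<int>"
    using prim vertex_in_lattice[OF i(1)] unfolding primitive_def by (intro inner_int_lattice) auto
  then obtain m :: int where m: "nF \<bullet> v i = real_of_int m"
    by (auto elim: Ints_cases)
  define h where "h = nat (- m)"
  have h: "h > 0" "nF \<bullet> v i = - real h"
    using neg m by (auto simp: h_def)

  have P_eq: "P = convex hull (insert (v i) F)"
  proof -
    have "v ` {..CARD('n)} = insert (v i) (v ` I)"
      using i(1) by (auto simp: I_def)
    then show ?thesis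
      unfolding hull F_eq by (metis hull_insert)
  qed
  let ?T = "mutation_map nF (real d) (real h / real d) (v i) u"
  have "(\<lambda>x. v i + (real h / real d) *\<^sub>R (x - u)) ` F = ?T ` F"
    using nF_F d by (intro image_cong) (simp_all add: mutation_map_facet)
  also have "\<dots> = convex hull (?T ` v ` I)"
    unfolding F_eq by (rule convex_hull_linear_image[OF linear_mutation_map])
  finally have image: "(\<lambda>x. v i + (real h / real d) *\<^sub>R (x - u)) ` F = convex hull (?T ` v ` I)" .
  have "mutation P F nF d u
      = convex hull (insert u ((\<lambda>x. v i + (real h / real d) *\<^sub>R (x - u)) ` F))"
    using uI nF_F d h vertex_in_lattice[OF i(1)] P_eq
    by (intro mutation_hull) (auto simp: F_eq hull_inc)
  also have "\<dots> = convex hull (insert u (?T ` v ` I))"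
    unfolding image by (metis hull_insert)
  finally have mut: "mutation P F nF d u = convex hull (insert u ((\<lambda>l. ?T (v l)) ` I))"
    by (simp add: image_image)
  have "(1 / real d) *\<^sub>R (v l - u) \<in> int_lattice" if "l \<in> I" for l
    using that uI by (intro admissible_vertex_differences[OF adm d]) (auto simp: extreme_F)
  then show ?thesis
    using that[OF i(1) h(1) d h(2)] nF_I uI mut unfolding I(2) I_def by auto
qed

text \<open>
  With \<open>T\<close> the mutation map, the vertices of the mutation are \<open>x l = c l *\<^sub>R T (v l)\<close>, where \<open>c l = 1\<close>
  except for \<open>c i = 1 / k\<^sup>2\<close>. The scaled vertex lies on every facet but the one opposite to it, and this
  is the reason for the two exponents \<open>n\<close> and \<open>n - 2\<close>. Here \<open>z = f \<circ> x\<close> labels the vertices of the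
  representative \<open>Q\<close>, and \<open>\<sigma>\<close> matches them with the given labelling \<open>w\<close>. The greatest common divisor
  comes from \<open>x i = u\<close> being a primitive vertex of \<open>P\<close>.
\<close>
lemma mutation_facet_indices:
  assumes related: "related_by_mutation P Q" and w: "vertex_labelling Q w"
  obtains i k z \<sigma> where "i \<le> CARD('n)" "k \<in> \<rat>" "k > 0"
    and "real (facet_index z i) = k ^ CARD('n) * real (facet_index v i)"
    and "\<And>l. l \<le> CARD('n) \<Longrightarrow> l \<noteq> i \<Longrightarrow>
      real (facet_index z l) = k powi (int CARD('n) - 2) * real (facet_index v l)"
    and "Gcd (weight z ` ({..CARD('n)} - {i})) = 1"
    and "bij_betw \<sigma> {..CARD('n)} {..CARD('n)}" "\<And>l. l \<le> CARD('n) \<Longrightarrow> w l = z (\<sigma> l)"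
proof -
  obtain F nF d u f where F: "F facet_of P" "facet_normal P F nF d" "admissible F d"
      "u extreme_point_of F"
    and f: "linear f" "f ` int_lattice = int_lattice" and Q: "f ` mutation P F nF d u = Q"
    using related unfolding related_by_mutation_def unimodular_equivalent_def by blast
  obtain i h where i: "i \<le> CARD('n)" and h: "h > 0" and d: "d > 0" and nF_i: "nF \<bullet> v i = - real h"
    and nF_l: "\<And>l. l \<le> CARD('n) \<Longrightarrow> l \<noteq> i \<Longrightarrow> nF \<bullet> v l = real d"
    and u: "u \<in> v ` ({..CARD('n)} - {i})"
    and diff: "\<And>l. l \<le> CARD('n) \<Longrightarrow> l \<noteq> i \<Longrightarrow> (1 / real d) *\<^sub>R (v l - u) \<in> int_lattice"
    and mut: "mutation P F nF d u = convex hull (insert u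
      ((\<lambda>l. mutation_map nF (real d) (real h / real d) (v i) u (v l)) ` ({..CARD('n)} - {i})))"
    using mutation_eq_hull[OF F] by blast
  define k where "k = real h / real d"
  have k: "k > 0" "k \<in> \<rat>" and kd: "k * real d = real h"
    using d h by (auto simp: k_def)
  define T where "T = mutation_map nF (real d) k (v i) u"
  have nF_u: "nF \<bullet> u = real d"
    using u nF_l by auto
  have T: "linear T"
    unfolding T_def by (rule linear_mutation_map)
  have det_T: "\<bar>det (matrix T)\<bar> = k ^ CARD('n)"
    unfolding T_def using nF_i nF_u d k(1) kd by (intro abs_det_mutation_map) auto
  define c where "c l = (if l = i then 1 / k\<^sup>2 else 1)" for l
  define x where "x l = c l *\<^sub>R T (v l)" for l
  have T_apex: "T (v i) = k\<^sup>2 *\<^sub>R u"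
    unfolding T_def using nF_i kd d by (intro mutation_map_apex) auto
  then have x_i: "x i = u"
    using k by (simp add: x_def c_def)
  have x_l: "x l = v i + real h *\<^sub>R ((1 / real d) *\<^sub>R (v l - u))" if "l \<le> CARD('n)" "l \<noteq> i" for l
    using nF_l[OF that] that d by (simp add: x_def c_def T_def mutation_map_facet k_def)
  have prim_x: "primitive (x i)"
    unfolding x_i using u primitive_vertex by auto
  have lat_x: "x l \<in> int_lattice" if "l \<le> CARD('n)" for l
  proof (cases "l = i")
    case True
    then show ?thesis
      using prim_x unfolding primitive_def by simp
  next
    case False
    then show ?thesis
      using that unfolding x_l[OF that False]
      by (intro int_lattice_add int_lattice_scaleR diff vertex_in_lattice i) auto
  qed
  define z where "z l = f (x l)" for l
  have "insert u ((\<lambda>l. T (v l)) ` ({..CARD('n)} - {i})) = x ` {..CARD('n)}"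
  proof -
    have "(\<lambda>l. T (v l)) ` ({..CARD('n)} - {i}) = x ` ({..CARD('n)} - {i})"
      by (rule image_cong) (auto simp: x_def c_def)
    then show ?thesis
      using i x_i by (metis atMost_iff image_insert insert_Diff)
  qed
  then have "Q = convex hull (z ` {..CARD('n)})"
    using Q mut convex_hull_linear_image[OF f(1)]
    by (simp add: z_def image_image T_def k_def)
  then obtain \<sigma> where \<sigma>: "bij_betw \<sigma> {..CARD('n)} {..CARD('n)}"
      "\<And>l. l \<le> CARD('n) \<Longrightarrow> w l = z (\<sigma> l)"
    using labelling_of_convex_hull[OF _ w] by blast

  have inj_f: "inj f"
    by (rule unimodular_map_inj[OF f])
  have lin: "linear (f \<circ> T)"
    using T f by (intro linear_compose)
  have det: "\<bar>det (matrix (f \<circ> T))\<bar> = k ^ CARD('n)"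
    using matrix_compose[OF T f(1)] abs_det_lattice_automorphism[OF f(1) inj_f f(2)] det_T
    by (simp add: det_mul abs_mult)
  then have inj: "inj (f \<circ> T)"
    using k det_nz_iff_inj[OF lin] by auto
  have index: "real (facet_index z j) = k ^ CARD('n) * (\<Prod>l\<in>{..CARD('n)} - {j}. \<bar>c l\<bar>) * real (facet_index v j)"
    if j: "j \<le> CARD('n)" for j
  proof -
    obtain e :: "'n \<Rightarrow> nat" where e: "bij_betw e UNIV ({..CARD('n)} - {j})"
      using facet_enumeration[OF j] .
    have "z l \<in> int_lattice" if "l \<le> CARD('n)" for l
      using lat_x[OF that] f(2) by (auto simp: z_def)
    then show ?thesis
      unfolding det[symmetric] using k
      by (intro facet_index_transform[OF e inj_facet_map[OF j e]] vertex_in_lattice lin inj)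
         (auto simp: z_def x_def c_def linear_cmul[OF f(1)])
  qed
  have index_i: "real (facet_index z i) = k ^ CARD('n) * real (facet_index v i)"
    using index[OF i] by (simp add: c_def)
  have index_l: "real (facet_index z l) = k powi (int CARD('n) - 2) * real (facet_index v l)"
    if "l \<le> CARD('n)" "l \<noteq> i" for l
  proof -
    have "(\<Prod>m\<in>{..CARD('n)} - {l}. \<bar>c m\<bar>) = (\<Prod>m\<in>{..CARD('n)} - {l}. if m = i then 1 / k\<^sup>2 else 1)"
      by (rule prod.cong) (auto simp: c_def)
    also have "\<dots> = 1 / k\<^sup>2"
      using i that(2) by (simp add: prod.delta)
    finally show ?thesis
      using index[OF that(1)] k by (simp add: power_int_diff)
  qed
  have pos_z: "facet_index z l > 0" if "l \<le> CARD('n)" for l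
  proof -
    have "real (facet_index z l) > 0"
      using facet_index_pos[OF that] index_i index_l[OF that] k by (cases "l = i") auto
    then show ?thesis
      by simp
  qed
  have "real (facet_index z l) *\<^sub>R x l = k powi (int CARD('n) - 2) *\<^sub>R T (real (facet_index v l) *\<^sub>R v l)"
    if "l \<le> CARD('n)" for l
    using index_i index_l[OF that] k
    by (cases "l = i") (auto simp: x_def c_def linear_cmul[OF T] power_int_diff)
  then have "(\<Sum>l\<le>CARD('n). real (facet_index z l) *\<^sub>R x l)
      = k powi (int CARD('n) - 2) *\<^sub>R T (\<Sum>l\<le>CARD('n). real (facet_index v l) *\<^sub>R v l)"
    by (simp add: linear_sum[OF T] scaleR_sum_right)
  then have rel: "(\<Sum>l\<le>CARD('n). real (facet_index z l) *\<^sub>R x l) = 0"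
    using facet_index_relation linear_0[OF T] by simp
  have "Gcd (weight z ` ({..CARD('n)} - {i})) = 1"
    by (rule Gcd_weight_facet[OF pos_z i rel lat_x prim_x])
  then show ?thesis
    using that[OF i k(2) k(1) index_i index_l _ \<sigma>] by blast
qed

text \<open>
  The weights off \<open>i\<close> do not change, so the multiplicity takes up the whole factor
  \<open>K = k powi (n - 2)\<close> of their facet indices. What is left for the weight with index \<open>i\<close> is
  \<open>k ^ n / K = k\<^sup>2\<close>, the square of a rational number, and so only its square part changes.
\<close>
lemma mutation_invariant:
  assumes related: "related_by_mutation P Q" and w: "vertex_labelling Q w"
  shows "(\<Prod>i\<le>CARD('n). real (markov_a v i)) powi (int CARD('n) - 2) / real (simplex_mult v) =
    (\<Prod>i\<le>CARD('n). real (markov_a w i)) powi (int CARD('n) - 2) / real (simplex_mult w)"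
proof -
  obtain i k z \<sigma> where i: "i \<le> CARD('n)" and k: "k \<in> \<rat>" "k > 0"
    and index_i: "real (facet_index z i) = k ^ CARD('n) * real (facet_index v i)"
    and index_l: "\<And>l. l \<le> CARD('n) \<Longrightarrow> l \<noteq> i \<Longrightarrow>
      real (facet_index z l) = k powi (int CARD('n) - 2) * real (facet_index v l)"
    and gcd_z: "Gcd (weight z ` ({..CARD('n)} - {i})) = 1"
    and \<sigma>: "bij_betw \<sigma> {..CARD('n)} {..CARD('n)}" "\<And>l. l \<le> CARD('n) \<Longrightarrow> w l = z (\<sigma> l)"
    using mutation_facet_indices[OF assms] by metis
  define K where "K = k powi (int CARD('n) - 2)"
  have K: "K > 0" "K * k\<^sup>2 = k ^ CARD('n)"
    using k by (auto simp: K_def power_int_diff)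
  have pos_z: "facet_index z l > 0" if "l \<le> CARD('n)" for l
  proof -
    have "real (facet_index z l) > 0"
      using facet_index_pos[OF that] index_i index_l[OF that] k by (cases "l = i") auto
    then show ?thesis
      by simp
  qed
  have fi_v: "facet_index v l = simplex_mult v * weight v l" if "l \<le> CARD('n)" for l
    by (rule facet_index_eq_mult_weight[OF facet_index_pos that])
  have fi_z: "facet_index z l = simplex_mult z * weight z l" if "l \<le> CARD('n)" for l
    by (rule facet_index_eq_mult_weight[OF pos_z that])
  have mult_pos: "simplex_mult v > 0" "simplex_mult z > 0"
    using simplex_mult_pos[OF facet_index_pos] simplex_mult_pos[OF pos_z] by auto
  have gcd_v: "Gcd (weight v ` ({..CARD('n)} - {i})) = 1"
    by (rule Gcd_weight_facet[OF facet_index_pos i facet_index_relation vertex_in_lattice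
          primitive_vertex[OF i]])
  have weight_l: "weight z l = weight v l" if l: "l \<in> {..CARD('n)} - {i}" for l
  proof (rule Gcd_1_proportional_eq[OF gcd_z gcd_v _ l])
    fix a b
    assume "a \<in> {..CARD('n)} - {i}" "b \<in> {..CARD('n)} - {i}"
    then have "real (facet_index z a) * real (facet_index v b)
        = real (facet_index v a) * real (facet_index z b)"
      using index_l by simp
    then have "facet_index z a * facet_index v b = facet_index v a * facet_index z b"
      by (metis of_nat_eq_iff of_nat_mult)
    then have "(simplex_mult v * simplex_mult z) * (weight z a * weight v b)
        = (simplex_mult v * simplex_mult z) * (weight v a * weight z b)"
      using fi_v fi_z \<open>a \<in> _\<close> \<open>b \<in> _\<close> by (simp add: mult.assoc mult.left_commute)
    then show "weight z a * weight v b = weight v a * weight z b"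
      using mult_pos by simp
  qed
  have mult_z: "real (simplex_mult z) = K * real (simplex_mult v)"
  proof -
    \<comment> \<open>Any label other than \<open>i\<close> will do.\<close>
    define l where "l = (if i = 0 then 1 else 0 :: nat)"
    have l: "l \<le> CARD('n)" "l \<noteq> i"
      by (auto simp: l_def Suc_le_eq)
    then have "real (simplex_mult z) * real (weight v l) = K * real (simplex_mult v) * real (weight v l)"
      using index_l[OF l] fi_v[OF l(1)] fi_z[OF l(1)] weight_l by (simp add: K_def)
    then show ?thesis
      using weight_pos[OF facet_index_pos l(1)] by simp
  qed
  have "K * real (simplex_mult v) * real (weight z i)
      = K * real (simplex_mult v) * (k\<^sup>2 * real (weight v i))"
    using index_i unfolding fi_v[OF i] fi_z[OF i] K(2)[symmetric] of_nat_mult mult_z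
    by (simp only: mult_ac)
  then have weight_i: "real (weight z i) = k\<^sup>2 * real (weight v i)"
    using K(1) mult_pos by simp
  have a_i: "real (markov_a z i) = k * real (markov_a v i)"
  proof -
    obtain h d :: nat where hd: "d \<noteq> 0" "k = real h / real d"
      using k by (metis Rats_abs_nat_div_natE abs_of_pos)
    then have "real (d\<^sup>2 * weight z i) = real (h\<^sup>2 * weight v i)"
      using weight_i by (simp add: power_divide)
    then have "square_part (d\<^sup>2 * weight z i) = square_part (h\<^sup>2 * weight v i)"
      by (metis of_nat_eq_iff)
    then have "d * markov_a z i = h * markov_a v i"
      by (simp add: square_part_square_mult markov_a_def)
    then have "real d * real (markov_a z i) = real h * real (markov_a v i)"
      by (metis of_nat_mult)
    then show ?thesis
      unfolding hd(2) using hd(1) by (simp add: field_simps)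
  qed
  have "(\<Prod>l\<le>CARD('n). real (markov_a z l))
      = real (markov_a z i) * (\<Prod>l\<in>{..CARD('n)} - {i}. real (markov_a z l))"
    using i by (simp add: prod.remove)
  also have "(\<Prod>l\<in>{..CARD('n)} - {i}. real (markov_a z l)) = (\<Prod>l\<in>{..CARD('n)} - {i}. real (markov_a v l))"
    by (rule prod.cong) (auto simp: markov_a_def weight_l)
  also have "real (markov_a z i) * (\<Prod>l\<in>{..CARD('n)} - {i}. real (markov_a v l))
      = k * (\<Prod>l\<le>CARD('n). real (markov_a v l))"
    using i by (simp add: a_i prod.remove)
  finally have "(\<Prod>l\<le>CARD('n). real (markov_a z l)) = k * (\<Prod>l\<le>CARD('n). real (markov_a v l))" .
  moreover have "(\<Prod>l\<le>CARD('n). real (markov_a w l)) = (\<Prod>l\<le>CARD('n). real (markov_a z l))"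
    using \<sigma> by (rule prod_markov_a_relabel)
  moreover have "simplex_mult w = simplex_mult z"
    using \<sigma> by (rule simplex_mult_relabel)
  ultimately show ?thesis
    using k(2) mult_z by (simp add: power_int_mult_distrib K_def)
qed

end

theorem theorem5p7:
  fixes P :: "(real ^ 'n) set" and v :: "nat \<Rightarrow> real ^ 'n"
  assumes "fano_simplex P" and "vertex_labelling P v"
  shows "measure lebesgue (polar_dual P) =
           markov_m v ^ CARD('n) / (fact CARD('n) * (\<Prod>i\<le>CARD('n). real (markov_c v i))) *
           ((\<Prod>i\<le>CARD('n). real (markov_a v i)) powi (int CARD('n) - 2) / real (simplex_mult v))
         \<and> (\<forall>Q w. related_by_mutation P Q \<longrightarrow> vertex_labelling Q w \<longrightarrow>
              (\<Prod>i\<le>CARD('n). real (markov_a v i)) powi (int CARD('n) - 2) / real (simplex_mult v) =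
              (\<Prod>i\<le>CARD('n). real (markov_a w i)) powi (int CARD('n) - 2) / real (simplex_mult w))"
proof -
  interpret labelled_fano_simplex P v
    using assms by unfold_locales
  show ?thesis
    using measure_polar_dual_markov mutation_invariant by blast
qed

end
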